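(* There exists a bounded-degree, connected, infinite graph $H$ and a vertex $v\in H$ such that $\mathrm{Comb}_v(\mathbb{Z},H)$ does not have the finite collision property; that is, two independent simple random walks on $\mathrm{Comb}_v(\mathbb{Z},H)$ collide (are at the same vertex at the same time) infinitely many times with positive probability.
   Context: For graphs $G,H$ and a vertex $v\in H$, $\mathrm{Comb}_v(G,H)$ is the graph with vertex set $V(G)\times V(H)$ and edge set $\{\{(x,w),(x,z)\}:\{w,z\}\in E(H),\,x\in V(G)\}\cup\{\{(x,v),(y,v)\}:\{x,y\}\in E(G)\}$. Here $\mathbb{Z}$ denotes the graph on the integers with edges between consecutive integers. An infinite graph has the finite collision property if for two independent simple random walks $(X_t),(Y_t)$ on it, the set $\{t: X_t=Y_t\}$ is almost surely finite. *)

theory Defs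
  imports "HOL-Probability.Probability"
begin

text \<open>Simple undirected graphs: a vertex set V and a symmetric irreflexive
  edge relation E supported on V.\<close>

definition simple_graph :: "'v set \<Rightarrow> ('v \<Rightarrow> 'v \<Rightarrow> bool) \<Rightarrow> bool" where
  "simple_graph V E \<longleftrightarrow>
     (\<forall>x y. E x y \<longrightarrow> x \<in> V \<and> y \<in> V) \<and> (\<forall>x y. E x y \<longrightarrow> E y x) \<and> (\<forall>x. \<not> E x x)"

definition nbrs :: "('v \<Rightarrow> 'v \<Rightarrow> bool) \<Rightarrow> 'v \<Rightarrow> 'v set" where
  "nbrs E x = {y. E x y}"

definition bounded_degree :: "'v set \<Rightarrow> ('v \<Rightarrow> 'v \<Rightarrow> bool) \<Rightarrow> bool" where
  "bounded_degree V E \<longleftrightarrow> (\<exists>d::nat. \<forall>x\<in>V. finite (nbrs E x) \<and> card (nbrs E x) \<le> d)"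

definition graph_connected :: "'v set \<Rightarrow> ('v \<Rightarrow> 'v \<Rightarrow> bool) \<Rightarrow> bool" where
  "graph_connected V E \<longleftrightarrow> (\<forall>x\<in>V. \<forall>y\<in>V. (x, y) \<in> {(a, b). E a b}\<^sup>*)"

text \<open>The graph \<open>\<int>\<close>: vertex set all integers, edges between consecutive integers.\<close>

definition Z_edge :: "int \<Rightarrow> int \<Rightarrow> bool" where
  "Z_edge x y \<longleftrightarrow> \<bar>x - y\<bar> = 1"

text \<open>The comb graph \<open>Comb_v(G,H)\<close>: vertex set \<open>V(G) \<times> V(H)\<close>.\<close>

definition comb_vertices :: "'a set \<Rightarrow> 'b set \<Rightarrow> ('a \<times> 'b) set" where
  "comb_vertices VG VH = VG \<times> VH"

definition comb_edge :: "('a \<Rightarrow> 'a \<Rightarrow> bool) \<Rightarrow> ('b \<Rightarrow> 'b \<Rightarrow> bool) \<Rightarrow> 'b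
    \<Rightarrow> ('a \<times> 'b) \<Rightarrow> ('a \<times> 'b) \<Rightarrow> bool" where
  "comb_edge EG EH v p q \<longleftrightarrow>
     (fst p = fst q \<and> EH (snd p) (snd q)) \<or>
     (snd p = v \<and> snd q = v \<and> EG (fst p) (fst q))"

text \<open>Probability that a simple random walk started at x0 follows the finite path p
  (p ! i is the position at time i).\<close>

definition srw_path_prob :: "('v \<Rightarrow> 'v \<Rightarrow> bool) \<Rightarrow> 'v \<Rightarrow> 'v list \<Rightarrow> real" where
  "srw_path_prob E x0 p =
     (if p ! 0 = x0 then
        (\<Prod>i<length p - 1. if E (p ! i) (p ! Suc i) then 1 / real (card (nbrs E (p ! i))) else 0)
      else 0)"

text \<open>X and Y are independent simple random walks on (V,E) started at x0 and y0:
  their joint finite-dimensional distributions are the products of the SRW path laws.\<close>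

definition indep_srws :: "'w measure \<Rightarrow> 'v set \<Rightarrow> ('v \<Rightarrow> 'v \<Rightarrow> bool) \<Rightarrow> 'v \<Rightarrow> 'v
    \<Rightarrow> (nat \<Rightarrow> 'w \<Rightarrow> 'v) \<Rightarrow> (nat \<Rightarrow> 'w \<Rightarrow> 'v) \<Rightarrow> bool" where
  "indep_srws M V E x0 y0 X Y \<longleftrightarrow>
     prob_space M \<and> x0 \<in> V \<and> y0 \<in> V \<and>
     (\<forall>t. X t \<in> M \<rightarrow>\<^sub>M count_space UNIV \<and> Y t \<in> M \<rightarrow>\<^sub>M count_space UNIV) \<and>
     (\<forall>n p q. length p = Suc n \<longrightarrow> length q = Suc n \<longrightarrow>
        measure M {\<omega> \<in> space M. \<forall>i\<le>n. X i \<omega> = p ! i \<and> Y i \<omega> = q ! i}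
          = srw_path_prob E x0 p * srw_path_prob E y0 q)"

text \<open>Finite collision property: for any two independent simple random walks
  (from any starting vertices), the set of collision times is almost surely finite.
  The walks are realised on the canonical path space of pairs of trajectories.\<close>

definition finite_collision_property :: "'v set \<Rightarrow> ('v \<Rightarrow> 'v \<Rightarrow> bool) \<Rightarrow> bool" where
  "finite_collision_property V E \<longleftrightarrow>
     (\<forall>(M :: (nat \<Rightarrow> 'v \<times> 'v) measure) x0 y0 X Y.
        indep_srws M V E x0 y0 X Y \<longrightarrow> (AE \<omega> in M. finite {t. X t \<omega> = Y t \<omega>}))"

end

theory Submission
  imports Defs
begin

text \<open>The graph \<open>H\<close> is a tree rooted at \<open>v\<close>: an infinite ray to which, at rapidly growing heights
  \<open>a\<^sub>k\<close>, a binary tree of depth \<open>a\<^sub>k\<close> is attached, with \<open>a\<^sub>k\<^sub>+\<^sub>1 = 64 a\<^sub>k\<^sup>2\<close>. Put \<open>R = 2 a\<^sub>k\<close> and let \<open>A\<close>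
  be the set of the vertices of depth at most \<open>R\<close>. The bare segment of the ray above \<open>A\<close> has
  length of order \<open>R\<^sup>2\<close>, which is negligible against \<open>|A| \<ge> 2^a\<^sub>k\<close>. Up to time \<open>T = |A| R\<^sup>2\<close> the walk
  on the comb visits the backbone about \<open>R\<^sup>2\<close> times; hence it moves a distance of order \<open>R\<close> along
  the backbone, is unlikely to pass the bare segment and spends little time in it. So during most of
  \<open>[0, T]\<close> it lives on about \<open>R |A|\<close> vertices, and by Cauchy--Schwarz the expected number of
  collisions there is at least of order \<open>T / (R |A|) = R\<close>. The expected number of returns up to time
  \<open>2 T\<close> to any of these vertices is at most of order \<open>R\<close>, which bounds the second moment, and the
  Paley--Zygmund inequality gives order \<open>R\<close> collisions with a probability bounded below uniformly
  in \<open>k\<close>.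

  All estimates for the walk come from explicit functions whose Laplacian is a difference of point
  masses: the length of the common part of the paths from the root to \<open>y\<close> and to \<open>w\<close>, as a function
  of \<open>w\<close>, and the distance along the backbone.\<close>

section \<open>Markov chains on a countable state space\<close>

text \<open>The randomness \<open>\<omega> (t, s)\<close> is the step taken at time \<open>t\<close> if the chain is then at \<open>s\<close>.\<close>

primrec trajectory :: "'s \<Rightarrow> nat \<Rightarrow> (nat \<times> 's \<Rightarrow> 's) \<Rightarrow> 's" where
  "trajectory s 0 \<omega> = s"
| "trajectory s (Suc t) \<omega> = \<omega> (t, trajectory s t \<omega>)"

primrec paths :: "('s \<Rightarrow> 's pmf) \<Rightarrow> nat \<Rightarrow> 's \<Rightarrow> 's list pmf" where
  "paths K 0 s = return_pmf [s]"
| "paths K (Suc n) s = bind_pmf (K s) (\<lambda>s'. map_pmf ((#) s) (paths K n s'))"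

lemma pmf_paths:
  "pmf (paths K n s) p =
     (if length p = Suc n \<and> p ! 0 = s then \<Prod>i<n. pmf (K (p ! i)) (p ! Suc i) else 0)"
proof (induction n arbitrary: s p)
  case 0
  show ?case by (cases p) (auto simp: length_Suc_conv indicator_def)
next
  case (Suc n)
  show ?case
  proof (cases p)
    case Nil
    have "pmf (map_pmf ((#) s) (paths K n x)) [] = 0" for x
      by (auto simp: pmf_eq_0_set_pmf)
    with Nil show ?thesis by (simp add: pmf_bind)
  next
    case (Cons x q)
    define c where "c = (if length q = Suc n then \<Prod>i<n. pmf (K (q ! i)) (q ! Suc i) else 0)"
    \<comment> \<open>As a function of the first step \<open>y\<close> the mass is a constant times
      the indicator of one point, so averaging over \<open>y\<close> leaves a single transition
      probability.\<close>
    have "pmf (map_pmf ((#) s) (paths K n y)) p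
        = (if x = s then c else 0) * indicat_real {q ! 0} y" for y
    proof (cases "x = s")
      case True
      have "pmf (map_pmf ((#) s) (paths K n y)) (s # q) = pmf (paths K n y) q"
        by (rule pmf_map_inj') (auto simp: inj_on_def)
      with True Cons show ?thesis
        by (simp add: Suc.IH c_def indicator_def)
    next
      case False
      then have "p \<notin> set_pmf (map_pmf ((#) s) (paths K n y))" using Cons by auto
      with False show ?thesis by (simp add: pmf_eq_0_set_pmf)
    qed
    then have "pmf (paths K (Suc n) s) p
        = measure_pmf.expectation (K s) (\<lambda>y. (if x = s then c else 0) * indicat_real {q ! 0} y)"
      by (simp add: pmf_bind)
    also have "\<dots> = (if x = s then c else 0) * pmf (K s) (q ! 0)"
      by (simp add: measure_pmf_single)
    also have "\<dots> = (if length p = Suc (Suc n) \<and> p ! 0 = s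
        then \<Prod>i<Suc n. pmf (K (p ! i)) (p ! Suc i) else 0)"
      unfolding Cons c_def prod.lessThan_Suc_shift by simp
    finally show ?thesis .
  qed
qed

text \<open>The next state reads \<open>\<omega>\<close> at a random coordinate; this is measurable
  because the coordinate takes countably many values and each fixed evaluation is
  measurable.\<close>

lemma measurable_trajectory:
  "trajectory s t \<in> PiM UNIV (\<lambda>(t::nat, s). measure_pmf (K s)) \<rightarrow>\<^sub>M count_space (UNIV :: 's::countable set)"
proof (induction t)
  case 0
  have "trajectory s 0 = (\<lambda>\<omega>. s)" by (auto simp: fun_eq_iff)
  then show ?case by simp
next
  case (Suc t)
  let ?N = "PiM UNIV (\<lambda>(t::nat, s). measure_pmf (K s))"
  have "(\<lambda>\<omega>. \<omega> (t, i)) \<in> ?N \<rightarrow>\<^sub>M count_space UNIV" for i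
  proof -
    have "(\<lambda>\<omega>. \<omega> (t, i)) \<in> ?N \<rightarrow>\<^sub>M (case (t, i) of (t::nat, s) \<Rightarrow> measure_pmf (K s))"
      by (rule measurable_component_singleton) simp
    moreover have "?N \<rightarrow>\<^sub>M measure_pmf (K i) = ?N \<rightarrow>\<^sub>M count_space UNIV"
      by (rule measurable_cong_sets) simp_all
    ultimately show ?thesis by simp
  qed
  then have "(\<lambda>\<omega>. \<omega> (t, trajectory s t \<omega>)) \<in> ?N \<rightarrow>\<^sub>M count_space UNIV"
    by (rule measurable_compose_countable[OF _ Suc])
  then show ?case by (simp add: fun_eq_iff cong: measurable_cong)
qed

text \<open>Following \<open>l\<close> from \<open>s\<close> constrains exactly the coordinates
  \<open>(i, l ! i)\<close> with \<open>i < n\<close>. They are distinct because their times are, so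
  the event is a cylinder and its probability is a product.\<close>

lemma prob_trajectory:
  fixes s :: "'s::countable" and K :: "'s \<Rightarrow> 's pmf"
  assumes l: "length l = Suc n"
  defines "N \<equiv> PiM UNIV (\<lambda>(t::nat, s). measure_pmf (K s))"
  shows "measure N {\<omega> \<in> space N. \<forall>i\<le>n. trajectory s i \<omega> = l ! i} = pmf (paths K n s) l"
proof (cases "l ! 0 = s")
  case False
  then have "{\<omega> \<in> space N. \<forall>i\<le>n. trajectory s i \<omega> = l ! i} = {}"
    by fastforce
  with False show ?thesis by (simp only: pmf_paths) simp
next
  case True
  let ?M = "\<lambda>(t::nat, s). measure_pmf (K s)"
  let ?J = "(\<lambda>i. (i, l ! i)) ` {..<n}"
  let ?X = "\<lambda>(i, s). {l ! Suc i}"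
  interpret product_prob_space ?M UNIV
    by (rule product_prob_spaceI) (auto intro: measure_pmf.prob_space_axioms)
  have "trajectory s i \<omega> = l ! i" if "\<forall>j<n. \<omega> (j, l ! j) = l ! Suc j" "i \<le> n" for i \<omega>
    using that(2) by (induction i) (use that True in auto)
  then have "(\<forall>i\<le>n. trajectory s i \<omega> = l ! i) \<longleftrightarrow> (\<forall>i<n. \<omega> (i, l ! i) = l ! Suc i)" for \<omega>
    by (metis Suc_leI less_imp_le trajectory.simps(2))
  then have "{\<omega> \<in> space N. \<forall>i\<le>n. trajectory s i \<omega> = l ! i} = prod_emb UNIV ?M ?J (Pi\<^sub>E ?J ?X)"
    by (auto simp: prod_emb_def N_def space_PiM PiE_iff split: prod.splits)
  moreover have "measure N (prod_emb UNIV ?M ?J (Pi\<^sub>E ?J ?X)) = (\<Prod>i\<in>?J. measure (?M i) (?X i))"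
    unfolding N_def by (rule measure_PiM_emb) auto
  moreover have "\<dots> = (\<Prod>i<n. pmf (K (l ! i)) (l ! Suc i))"
    by (subst prod.reindex) (auto simp: inj_on_def measure_pmf_single)
  ultimately show ?thesis using True l by (simp add: pmf_paths)
qed

text \<open>The chain is carried over to the space of sequences of states, because
  \<open>finite_collision_property\<close> quantifies over measures on that type.\<close>

theorem markov_chain_exists:
  fixes K :: "'s::countable \<Rightarrow> 's pmf"
  obtains M :: "(nat \<Rightarrow> 's) measure" where "prob_space M"
    "\<And>t. (\<lambda>\<omega>. \<omega> t) \<in> M \<rightarrow>\<^sub>M count_space UNIV"
    "\<And>ts. (\<lambda>\<omega>. map \<omega> ts) \<in> M \<rightarrow>\<^sub>M count_space UNIV"
    "\<And>n. distr M (count_space UNIV) (\<lambda>\<omega>. map \<omega> [0..<Suc n]) = measure_pmf (paths K n s)"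
proof
  let ?N = "PiM UNIV (\<lambda>(t::nat, s). measure_pmf (K s))"
  define M where "M = distr ?N (PiM UNIV (\<lambda>_::nat. count_space UNIV)) (\<lambda>\<omega> t. trajectory s t \<omega>)"
  have N: "prob_space ?N"
    by (rule prob_space_PiM) (auto intro: measure_pmf.prob_space_axioms)
  have meas: "(\<lambda>\<omega> t. trajectory s t \<omega>) \<in> ?N \<rightarrow>\<^sub>M PiM UNIV (\<lambda>_::nat. count_space UNIV)"
    by (rule measurable_abs_UNIV) (rule measurable_trajectory)
  show M: "prob_space M"
    unfolding M_def by (rule prob_space.prob_space_distr[OF N meas])
  show coord: "(\<lambda>\<omega>. \<omega> t) \<in> M \<rightarrow>\<^sub>M count_space UNIV" for t
    unfolding M_def by (simp add: measurable_component_singleton)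
  show map: "(\<lambda>\<omega>. map \<omega> ks) \<in> M \<rightarrow>\<^sub>M count_space UNIV" for ks
  proof (induction ks)
    case (Cons k ks)
    show ?case
      using measurable_compose_countable[where f = "\<lambda>x \<omega>. x # map \<omega> ks" and g = "\<lambda>\<omega>. \<omega> k", OF _ coord]
      by (simp add: measurable_compose[OF Cons])
  qed simp
  fix n
  show "distr M (count_space UNIV) (\<lambda>\<omega>. map \<omega> [0..<Suc n]) = measure_pmf (paths K n s)"
  proof (rule measure_eqI_countable)
    fix l :: "'s list"
    interpret prob_space M by (rule M)
    have "emeasure (distr M (count_space UNIV) (\<lambda>\<omega>. map \<omega> [0..<Suc n])) {l}
        = emeasure M ((\<lambda>\<omega>. map \<omega> [0..<Suc n]) -` {l} \<inter> space M)"
      by (rule emeasure_distr[OF map]) simp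
    also have "\<dots> = ennreal (pmf (paths K n s) l)"
    proof (cases "length l = Suc n")
      case False
      then have "(\<lambda>\<omega>. map \<omega> [0..<Suc n]) -` {l} \<inter> space M = {}" by auto
      then show ?thesis using False by (simp only: pmf_paths) simp
    next
      case True
      have e: "(\<lambda>\<omega>. map \<omega> [0..<Suc n]) -` {l} \<inter> space M = {\<omega> \<in> space M. \<forall>i\<le>n. \<omega> i = l ! i}"
        using True by (auto simp: list_eq_iff_nth_eq less_Suc_eq_le simp del: upt_Suc)
      have "(\<lambda>\<omega>. map \<omega> [0..<Suc n]) -` {l} \<inter> space M \<in> sets M"
        by (rule measurable_sets[OF map]) simp
      then have "measure M {\<omega> \<in> space M. \<forall>i\<le>n. \<omega> i = l ! i}
          = measure ?N {\<omega> \<in> space ?N. \<forall>i\<le>n. trajectory s i \<omega> = l ! i}"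
        unfolding e unfolding M_def
        by (subst measure_distr[OF meas]) (auto intro!: arg_cong[where f = "measure _"] simp: space_PiM)
      then show ?thesis
        using True by (simp only: emeasure_eq_measure e prob_trajectory)
    qed
    finally show "emeasure (distr M (count_space UNIV) (\<lambda>\<omega>. map \<omega> [0..<Suc n])) {l}
        = emeasure (measure_pmf (paths K n s)) {l}"
      by (simp add: emeasure_pmf_single)
  qed auto
qed

section \<open>Collisions of two walks\<close>

text \<open>The transition operator of the walk: \<open>(avg nb ^^ t) (indicator {y}) x\<close> is
  the probability of being at \<open>y\<close> after \<open>t\<close> steps from
  \<open>x\<close>.\<close>

definition avg :: "('s \<Rightarrow> 's set) \<Rightarrow> ('s \<Rightarrow> real) \<Rightarrow> 's \<Rightarrow> real" where
  "avg nb f s = (\<Sum>y\<in>nb s. f y) / real (card (nb s))"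

definition occupation :: "'s set \<Rightarrow> 's list \<Rightarrow> real" where
  "occupation D p = (\<Sum>s\<leftarrow>p. indicator D s)"

lemma occupation_Cons [simp]: "occupation D (s # p) = indicator D s + occupation D p"
  and occupation_Nil [simp]: "occupation D [] = 0"
  by (simp_all add: occupation_def)

lemma occupation_eq_card: "occupation D p = real (card {i. i < length p \<and> p ! i \<in> D})"
  unfolding occupation_def indicator_def
  by (simp add: sum_list_sum_nth sum.If_cases atLeast0LessThan Int_def)

text \<open>With \<open>\<theta> = m / 2\<close>, the indicator of \<open>\<theta> \<le> f\<close>
  dominates the parabola \<open>1 - (1 - (f - \<theta>) / b)\<^sup>2\<close>, which is at most 1 and
  is not positive for \<open>f < \<theta>\<close>. Its expectation involves only the first two
  moments.\<close>

lemma paley_zygmund_pmf: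
  fixes f :: "'a \<Rightarrow> real"
  assumes fin: "finite (set_pmf p)" and B: "0 < B" and m: "0 < m"
    and first: "m \<le> measure_pmf.expectation p f"
    and second: "measure_pmf.expectation p (\<lambda>x. (f x)\<^sup>2) \<le> B * measure_pmf.expectation p f"
  shows "m / (4 * B) \<le> measure_pmf.prob p {x. m / 2 \<le> f x}"
proof -
  have int: "integrable (measure_pmf p) g" for g :: "'a \<Rightarrow> real"
    by (rule integrable_measure_pmf_finite[OF fin])
  let ?E = "measure_pmf.expectation p"
  \<comment> \<open>With \<open>b = 2 * B\<close> the linear term is at least
    \<open>2 * B * \<mu>\<close>, while the second moment costs at most
    \<open>B * \<mu>\<close>.\<close>
  define \<theta> \<mu> b where "\<theta> = m / 2" and "\<mu> = ?E f" and "b = 2 * B"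
  have b: "b > 0" using B by (simp add: b_def)
  have "(2 * b * (f x - \<theta>) - (f x - \<theta>)\<^sup>2) / b\<^sup>2 \<le> indicator {x. \<theta> \<le> f x} x" for x
  proof (cases "\<theta> \<le> f x")
    case True
    have "0 \<le> (b - (f x - \<theta>))\<^sup>2" by simp
    then have "2 * b * (f x - \<theta>) - (f x - \<theta>)\<^sup>2 \<le> b\<^sup>2"
      by (simp add: power2_eq_square algebra_simps)
    with True b show ?thesis by (simp add: divide_le_eq)
  next
    case False
    then have "2 * b * (f x - \<theta>) - (f x - \<theta>)\<^sup>2 \<le> 0"
      using b by (smt (verit) mult_pos_neg zero_le_power2)
    with False b show ?thesis by (simp add: divide_le_0_iff)
  qed
  then have "?E (\<lambda>x. (2 * b * (f x - \<theta>) - (f x - \<theta>)\<^sup>2) / b\<^sup>2) \<le> ?E (indicator {x. \<theta> \<le> f x})"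
    by (intro integral_mono int) auto
  also have "?E (\<lambda>x. (2 * b * (f x - \<theta>) - (f x - \<theta>)\<^sup>2) / b\<^sup>2)
      = (2 * b * (\<mu> - \<theta>) - (?E (\<lambda>x. (f x)\<^sup>2) - 2 * \<theta> * \<mu> + \<theta>\<^sup>2)) / b\<^sup>2"
    by (simp add: power2_diff int \<mu>_def Bochner_Integration.integral_diff
        Bochner_Integration.integral_add right_diff_distrib mult.assoc mult.left_commute)
  finally have "(2 * b * (\<mu> - \<theta>) - (?E (\<lambda>x. (f x)\<^sup>2) - 2 * \<theta> * \<mu> + \<theta>\<^sup>2)) / b\<^sup>2
      \<le> measure_pmf.prob p {x. \<theta> \<le> f x}" by simp
  moreover have "m / (4 * B) \<le> (2 * b * (\<mu> - \<theta>) - (?E (\<lambda>x. (f x)\<^sup>2) - 2 * \<theta> * \<mu> + \<theta>\<^sup>2)) / b\<^sup>2"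
  proof -
    have "\<theta> \<le> \<mu> / 2" using first by (simp add: \<theta>_def \<mu>_def)
    then have "b * \<mu> \<le> 2 * b * (\<mu> - \<theta>)" using b by (simp add: mult.commute mult.left_commute field_simps)
    moreover have "\<theta>\<^sup>2 \<le> 2 * \<theta> * \<mu>"
      using \<open>\<theta> \<le> \<mu> / 2\<close> m by (simp add: power2_eq_square \<theta>_def)
    moreover have "b * \<mu> - B * \<mu> \<ge> B * m"
      using first B by (simp add: b_def \<mu>_def)
    ultimately have "B * m \<le> 2 * b * (\<mu> - \<theta>) - (?E (\<lambda>x. (f x)\<^sup>2) - 2 * \<theta> * \<mu> + \<theta>\<^sup>2)"
      using second unfolding \<mu>_def by linarith
    then show ?thesis using B by (simp add: b_def field_simps power2_eq_square)
  qed
  ultimately show ?thesis by (simp add: \<theta>_def)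
qed

section \<open>The transition operator and moments of occupation times\<close>

locale neighbourhoods =
  fixes nb :: "'s \<Rightarrow> 's set"
  assumes finite_nb [simp]: "finite (nb s)" and nb_nonempty [simp]: "nb s \<noteq> {}"
begin

abbreviation P where "P \<equiv> avg nb"

abbreviation law :: "nat \<Rightarrow> 's \<Rightarrow> 's list pmf" where
  "law \<equiv> paths (\<lambda>s. pmf_of_set (nb s))"

lemma card_nb_pos [simp]: "0 < card (nb s)" "card (nb s) \<noteq> 0"
  by (simp_all add: card_gt_0_iff)

lemma avg_const [simp]: "P (\<lambda>_. c) s = c"
  by (simp add: avg_def)

lemma avg_mono: "(\<And>y. f y \<le> g y) \<Longrightarrow> P f s \<le> P g s"
  by (simp add: avg_def divide_right_mono sum_mono)

lemma avg_add: "P (\<lambda>y. f y + g y) s = P f s + P g s"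
  by (simp add: avg_def sum.distrib add_divide_distrib)

lemma avg_cmult: "P (\<lambda>y. c * f y) s = c * P f s"
  by (simp add: avg_def sum_distrib_left)

lemma avg_sum: "P (\<lambda>y. \<Sum>i\<in>I. f i y) s = (\<Sum>i\<in>I. P (f i) s)"
  by (simp add: avg_def sum_divide_distrib[symmetric] sum.swap[of _ I])

lemma pow_const [simp]: "(P ^^ n) (\<lambda>_. c) s = c"
proof (induction n arbitrary: s)
  case (Suc n)
  then have "(P ^^ n) (\<lambda>_. c) = (\<lambda>_. c)" by (rule ext)
  then show ?case by simp
qed simp

lemma pow_mono: "(\<And>y. f y \<le> g y) \<Longrightarrow> (P ^^ n) f s \<le> (P ^^ n) g s"
  by (induction n arbitrary: s) (auto intro!: avg_mono)

lemma pow_add: "(P ^^ n) (\<lambda>y. f y + g y) s = (P ^^ n) f s + (P ^^ n) g s"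
proof (induction n arbitrary: s)
  case (Suc n)
  have "(P ^^ n) (\<lambda>y. f y + g y) = (\<lambda>s. (P ^^ n) f s + (P ^^ n) g s)"
    by (rule ext) (rule Suc)
  then show ?case by (simp add: avg_add)
qed simp

lemma pow_cmult: "(P ^^ n) (\<lambda>y. c * f y) s = c * (P ^^ n) f s"
proof (induction n arbitrary: s)
  case (Suc n)
  have "(P ^^ n) (\<lambda>y. c * f y) = (\<lambda>s. c * (P ^^ n) f s)"
    by (rule ext) (rule Suc)
  then show ?case by (simp add: avg_cmult)
qed simp

lemma pow_diff: "(P ^^ n) (\<lambda>y. f y - g y) s = (P ^^ n) f s - (P ^^ n) g s"
  using pow_add[of n f "\<lambda>y. (-1) * g y" s] pow_cmult[of n "-1" g s] by simp

lemma pow_sum: "finite I \<Longrightarrow> (P ^^ n) (\<lambda>y. \<Sum>i\<in>I. f i y) s = (\<Sum>i\<in>I. (P ^^ n) (f i) s)"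
  by (induction I rule: finite_induct) (simp_all add: pow_add)

lemma pow_nonneg: "(\<And>y. 0 \<le> f y) \<Longrightarrow> 0 \<le> (P ^^ n) f s"
  using pow_mono[of "\<lambda>_. 0" f n s] by simp

lemma pow_le_const: "(\<And>y. f y \<le> c) \<Longrightarrow> (P ^^ n) f s \<le> c"
  using pow_mono[of f "\<lambda>_. c" n s] by simp

text \<open>The discrete Dynkin formula: a function with known Laplacian \<open>g\<close> gives the
  expected accumulated value of \<open>g\<close> along the walk.\<close>

lemma pow_telescope:
  assumes "\<And>y. P f y - f y = g y"
  shows "(P ^^ n) f s - f s = (\<Sum>t<n. (P ^^ t) g s)"
proof (induction n)
  case (Suc n)
  have g: "g = (\<lambda>y. P f y - f y)" using assms by (simp add: fun_eq_iff)
  have "(P ^^ Suc n) f s = (P ^^ n) (P f) s" by (simp only: funpow_Suc_right o_apply)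
  moreover have "(P ^^ n) g s = (P ^^ n) (P f) s - (P ^^ n) f s"
    unfolding g by (rule pow_diff)
  ultimately show ?case using Suc by simp
qed simp

lemma finite_set_law: "finite (set_pmf (law n s))"
  by (induction n arbitrary: s) simp_all

lemma integrable_law [simp]: "integrable (measure_pmf (law n s)) (F :: _ \<Rightarrow> real)"
  by (rule integrable_measure_pmf_finite[OF finite_set_law])

lemma expectation_law_Suc:
  fixes F :: "'s list \<Rightarrow> real"
  shows "measure_pmf.expectation (law (Suc n) s) F
    = P (\<lambda>y. measure_pmf.expectation (law n y) (\<lambda>p. F (s # p))) s"
proof -
  have "measure_pmf.expectation (law (Suc n) s) F
      = (\<Sum>y\<in>nb s. pmf (pmf_of_set (nb s)) y *\<^sub>R
           measure_pmf.expectation (map_pmf ((#) s) (law n y)) F)"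
    unfolding paths.simps
    by (rule pmf_expectation_bind) (simp_all add: finite_set_law)
  also have "\<dots> = (\<Sum>y\<in>nb s. measure_pmf.expectation (law n y) (\<lambda>p. F (s # p)) / real (card (nb s)))"
    by (intro sum.cong) simp_all
  finally show ?thesis by (simp add: avg_def sum_divide_distrib)
qed

lemma expectation_occupation:
  "measure_pmf.expectation (law n s) (occupation D) = (\<Sum>t\<le>n. (P ^^ t) (indicator D) s)"
proof (induction n arbitrary: s)
  case (Suc n)
  have "measure_pmf.expectation (law (Suc n) s) (occupation D)
      = P (\<lambda>y. indicator D s + measure_pmf.expectation (law n y) (occupation D)) s"
    by (simp only: expectation_law_Suc occupation_Cons) simp
  also have "\<dots> = indicator D s + (\<Sum>t\<le>n. P ((P ^^ t) (indicator D)) s)"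
    by (simp only: Suc avg_add avg_const avg_sum)
  also have "\<dots> = (\<Sum>t\<le>Suc n. (P ^^ t) (indicator D) s)"
    by (simp add: sum.atMost_Suc_shift del: sum.atMost_Suc)
  finally show ?case .
qed simp

text \<open>The square counts pairs of visits, and after the earlier visit of a pair at most
  \<open>C\<close> visits are expected. In the induction a start in \<open>D\<close> adds one plus
  twice the later expected occupation, which is at most \<open>2 * C\<close>.\<close>

lemma expectation_occupation_square:
  assumes "\<And>x k. x \<in> D \<Longrightarrow> k \<le> n \<Longrightarrow> measure_pmf.expectation (law k x) (occupation D) \<le> C"
  shows "measure_pmf.expectation (law n s) (\<lambda>p. (occupation D p)\<^sup>2)
    \<le> 2 * C * measure_pmf.expectation (law n s) (occupation D)"
  using assms
proof (induction n arbitrary: s)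
  case 0
  show ?case
  proof (cases "s \<in> D")
    case True
    then show ?thesis using "0.prems"[of s 0] by simp
  qed simp
next
  case (Suc n)
  let ?E = "\<lambda>n s. measure_pmf.expectation (law n s)"
  let ?I = "indicator D s :: real"
  have E: "?E (Suc n) s (occupation D) = ?I + P (\<lambda>y. ?E n y (occupation D)) s"
    by (simp only: expectation_law_Suc occupation_Cons) (simp add: avg_add)
  have "?E (Suc n) s (\<lambda>p. (occupation D p)\<^sup>2)
      = P (\<lambda>y. ?I + (2 * ?I * ?E n y (occupation D) + ?E n y (\<lambda>p. (occupation D p)\<^sup>2))) s"
    by (simp only: expectation_law_Suc occupation_Cons power2_sum)
      (simp add: power2_eq_square indicator_def add_ac)
  also have "\<dots> = ?I + 2 * ?I * P (\<lambda>y. ?E n y (occupation D)) s + P (\<lambda>y. ?E n y (\<lambda>p. (occupation D p)\<^sup>2)) s"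
    by (simp only: avg_add avg_cmult avg_const)
  also have "P (\<lambda>y. ?E n y (\<lambda>p. (occupation D p)\<^sup>2)) s \<le> P (\<lambda>y. 2 * C * ?E n y (occupation D)) s"
    by (rule avg_mono) (rule Suc.IH, use Suc.prems in auto)
  also have "\<dots> = 2 * C * P (\<lambda>y. ?E n y (occupation D)) s"
    by (rule avg_cmult)
  also have "?I + 2 * ?I * P (\<lambda>y. ?E n y (occupation D)) s \<le> 2 * C * ?I"
    using Suc.prems[of s "Suc n"] unfolding E
    by (auto simp: indicator_def)
  finally show ?case unfolding E by (simp add: algebra_simps)
qed

end

text \<open>Two independent walks form one walk that moves uniformly on products of neighbourhoods;
  its operator factors on product functions.\<close>

lemma avg_Times:
  "avg (\<lambda>(x, y). nb x \<times> nb y) (\<lambda>(x, y). f x * g y) (x, y) = avg nb f x * avg nb g y"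
  by (simp add: avg_def sum.cartesian_product[symmetric] sum_product card_cartesian_product)

lemma pow_avg_Times:
  "(avg (\<lambda>(x, y). nb x \<times> nb y) ^^ n) (\<lambda>(x, y). f x * g y) (x, y)
    = (avg nb ^^ n) f x * (avg nb ^^ n) g y"
proof (induction n arbitrary: x y)
  case (Suc n)
  then have "(avg (\<lambda>(x, y). nb x \<times> nb y) ^^ n) (\<lambda>(x, y). f x * g y)
      = (\<lambda>(x, y). (avg nb ^^ n) f x * (avg nb ^^ n) g y)" by auto
  then show ?case by (simp add: avg_Times)
qed simp

section \<open>Reversibility and moments of the number of collisions\<close>

locale walk_graph = neighbourhoods "nbrs E" for E :: "'s \<Rightarrow> 's \<Rightarrow> bool" +
  assumes sym: "E x y \<Longrightarrow> E y x"
begin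

definition deg :: "'s \<Rightarrow> real" where "deg x = real (card (nbrs E x))"

lemma deg_pos [simp]: "0 < deg x" "deg x \<noteq> 0"
  by (simp_all add: deg_def)

lemma avg_minus_self: "P f x - f x = (\<Sum>y\<in>nbrs E x. f y - f x) / deg x"
  by (simp add: avg_def deg_def sum_subtractf diff_divide_distrib)

text \<open>In the induction the walk from \<open>y\<close> to \<open>x\<close> loses its last step,
  which leaves it at a neighbour \<open>u\<close> of \<open>x\<close>; the walk from
  \<open>x\<close> to \<open>y\<close> loses its first step, to the same \<open>u\<close>.\<close>

lemma reversible: "deg x * (P ^^ n) (indicator {y}) x = deg y * (P ^^ n) (indicator {x}) y"
proof (induction n arbitrary: x y)
  case (Suc n)
  have mem: "v \<in> nbrs E u \<longleftrightarrow> u \<in> nbrs E v" for u v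
    using sym by (auto simp: nbrs_def)
  have "P (indicator {x}) = (\<lambda>z. \<Sum>u\<in>nbrs E x. (1 / deg u) * indicator {u} z)"
  proof
    fix z
    have "P (indicator {x}) z = (if x \<in> nbrs E z then 1 / deg z else 0)"
      by (simp add: avg_def deg_def indicator_def)
    moreover have "(\<Sum>u\<in>nbrs E x. (1 / deg u) * indicator {u} z)
        = (\<Sum>u\<in>nbrs E x. if u = z then 1 / deg z else 0)"
      by (intro sum.cong) (auto simp: indicator_def)
    ultimately show "P (indicator {x}) z = (\<Sum>u\<in>nbrs E x. (1 / deg u) * indicator {u} z)"
      by (simp add: mem)
  qed
  then have "(P ^^ Suc n) (indicator {x}) y
      = (P ^^ n) (\<lambda>z. \<Sum>u\<in>nbrs E x. (1 / deg u) * indicator {u} z) y"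
    by (simp only: funpow_Suc_right o_apply)
  also have "\<dots> = (\<Sum>u\<in>nbrs E x. (1 / deg u) * (P ^^ n) (indicator {u}) y)"
    by (simp only: pow_sum finite_nb pow_cmult)
  finally have "deg y * (P ^^ Suc n) (indicator {x}) y
      = (\<Sum>u\<in>nbrs E x. (1 / deg u) * (deg y * (P ^^ n) (indicator {u}) y))"
    by (simp add: sum_distrib_left mult.left_commute)
  also have "\<dots> = (\<Sum>u\<in>nbrs E x. (P ^^ n) (indicator {y}) u)"
    by (intro sum.cong) (simp_all add: Suc[symmetric])
  also have "\<dots> = deg x * (P ^^ Suc n) (indicator {y}) x"
    by (simp add: avg_def deg_def)
  finally show ?case by simp
qed (simp add: indicator_def)

text \<open>Reversing one of two walks that start at \<open>x\<close> and meet at time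
  \<open>n\<close> produces a walk from \<open>x\<close> back to \<open>x\<close> of length
  \<open>2 * n\<close>; the reversal costs a factor of at most \<open>d\<close>.\<close>

lemma sum_return_le:
  assumes "finite A" and d: "\<And>z. deg z \<le> d"
  shows "(\<Sum>z\<in>A. ((P ^^ n) (indicator {z}) x)\<^sup>2) \<le> d * (P ^^ (2 * n)) (indicator {x}) x"
proof -
  have deg1: "1 \<le> deg u" for u
    using card_nb_pos(1)[of u] unfolding deg_def by linarith
  let ?p = "\<lambda>x z. (P ^^ n) (indicator {z}) x"
  have p0: "0 \<le> ?p x z" for x z by (rule pow_nonneg) simp
  have le: "?p x z \<le> d * ?p z x" for z
  proof -
    have "?p x z \<le> deg x * ?p x z"
      using mult_right_mono[OF deg1 p0] by simp
    also have "\<dots> = deg z * ?p z x" by (rule reversible)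
    also have "\<dots> \<le> d * ?p z x" by (rule mult_right_mono[OF d p0])
    finally show ?thesis .
  qed
  have "(\<Sum>z\<in>A. (?p x z)\<^sup>2) \<le> (\<Sum>z\<in>A. d * ?p z x * ?p x z)"
    unfolding power2_eq_square by (intro sum_mono mult_right_mono le p0)
  also have "\<dots> = d * (P ^^ n) (\<lambda>y. \<Sum>z\<in>A. ?p z x * indicator {z} y) x"
    by (simp only: pow_sum[OF assms(1)] pow_cmult sum_distrib_left mult.assoc)
  also have "\<dots> \<le> d * (P ^^ n) (\<lambda>y. ?p y x) x"
  proof (intro mult_left_mono pow_mono)
    fix y
    have "(\<Sum>z\<in>A. ?p z x * indicator {z} y) = (\<Sum>z\<in>A. if z = y then ?p y x else 0)"
      by (intro sum.cong) (auto simp: indicator_def)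
    then show "(\<Sum>z\<in>A. ?p z x * indicator {z} y) \<le> ?p y x"
      using assms(1) p0 by simp
    show "0 \<le> d" using deg1[of x] d[of x] by linarith
  qed
  also have "(P ^^ n) (\<lambda>y. ?p y x) x = (P ^^ (2 * n)) (indicator {x}) x"
    by (simp add: mult_2 funpow_add)
  finally show ?thesis .
qed

abbreviation nbrs2 :: "'s \<times> 's \<Rightarrow> ('s \<times> 's) set" where
  "nbrs2 \<equiv> \<lambda>(x, y). nbrs E x \<times> nbrs E y"

lemma neighbourhoods_pair: "neighbourhoods nbrs2"
  by unfold_locales auto

text \<open>The pair walk visits the diagonal over \<open>A\<close> exactly at collisions in
  \<open>A\<close>. Cauchy--Schwarz bounds their expected number from below; the return bound gives
  \<open>expectation_occupation_square\<close> with \<open>C = d * G\<close>, and Paley--Zygmund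
  applies with \<open>B = 2 * (d * G)\<close>.\<close>

theorem many_collisions:
  assumes A: "finite A" "A \<noteq> {}" and d: "\<And>z. deg z \<le> d" and G: "0 < G"
    and occ: "real (Suc n) / 2 \<le> (\<Sum>t\<le>n. (P ^^ t) (indicator A) x)"
    and green: "\<And>y. y \<in> A \<Longrightarrow> (\<Sum>t\<le>2 * n. (P ^^ t) (indicator {y}) y) \<le> G"
    and m: "0 < m" "m \<le> real (Suc n) / (4 * real (card A))"
  shows "m / (8 * d * G) \<le> measure_pmf.prob (paths (\<lambda>s. pmf_of_set (nbrs2 s)) n (x, x))
    {p. m / 2 \<le> occupation {(y, y) |y. y \<in> A} p}"
proof -
  interpret pair: neighbourhoods nbrs2 by (rule neighbourhoods_pair)
  let ?D = "{(y, y) |y. y \<in> A}"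
  have d0: "0 < d" using d[of x] deg_pos(1)[of x] by linarith
  have ind: "indicator ?D = (\<lambda>s. \<Sum>z\<in>A. (\<lambda>(x, y). indicator {z} x * indicator {z} y :: real) s)"
  proof
    fix s :: "'s \<times> 's"
    obtain a b where s: "s = (a, b)" by (cases s)
    have "(\<Sum>z\<in>A. indicator {z} a * indicator {z} b :: real)
        = (\<Sum>z\<in>A. if z = a then (if a = b then 1 else 0) else 0)"
      by (intro sum.cong) (auto simp: indicator_def)
    then show "indicator ?D s = (\<Sum>z\<in>A. (\<lambda>(x, y). indicator {z} x * indicator {z} y :: real) s)"
      using A(1) by (auto simp: s indicator_def)
  qed
  have pow: "(avg nbrs2 ^^ t) (indicator ?D) (y, y) = (\<Sum>z\<in>A. ((P ^^ t) (indicator {z}) y)\<^sup>2)" for t y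
    unfolding ind using A(1)
    by (subst pair.pow_sum) (simp_all add: pow_avg_Times power2_eq_square)
  let ?E = "\<lambda>k s. measure_pmf.expectation (pair.law k s) (occupation ?D)"
  have "?E k s \<le> d * G" if s: "s \<in> ?D" and k: "k \<le> n" for k s
  proof -
    obtain y where y: "s = (y, y)" "y \<in> A" using s by auto
    have "?E k s = (\<Sum>t\<le>k. \<Sum>z\<in>A. ((P ^^ t) (indicator {z}) y)\<^sup>2)"
      by (simp add: pair.expectation_occupation y pow)
    also have "\<dots> \<le> (\<Sum>t\<le>k. d * (P ^^ (2 * t)) (indicator {y}) y)"
      by (intro sum_mono sum_return_le A d)
    \<comment> \<open>The return times that occur are the even ones up to \<open>2 * k\<close>; the
      remaining times are then added, which explains the horizon \<open>2 * n\<close> for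
      \<open>green\<close>.\<close>
    also have "\<dots> = d * (\<Sum>t\<in>(*) 2 ` {..k}. (P ^^ t) (indicator {y}) y)"
      by (simp add: sum_distrib_left sum.reindex inj_on_def)
    also have "\<dots> \<le> d * (\<Sum>t\<le>2 * n. (P ^^ t) (indicator {y}) y)"
      using d0 k by (intro mult_left_mono sum_mono2) (auto intro: pow_nonneg)
    also have "\<dots> \<le> d * G"
      using green[OF y(2)] d0 by simp
    finally show ?thesis .
  qed
  then have second: "measure_pmf.expectation (pair.law n (x, x)) (\<lambda>p. (occupation ?D p)\<^sup>2)
      \<le> 2 * (d * G) * ?E n (x, x)"
    by (rule pair.expectation_occupation_square)
  let ?a = "\<lambda>t. (P ^^ t) (indicator A) x"
  have cA: "0 < real (card A)" using A by (simp add: card_gt_0_iff)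
  have ineq: "(\<Sum>t\<in>T. f t)\<^sup>2 \<le> real (card T) * (\<Sum>t\<in>T. (f t)\<^sup>2)" for f :: "'b \<Rightarrow> real" and T
    using Cauchy_Schwarz_ineq_sum[of "\<lambda>_. 1" f T] by simp
  \<comment> \<open>Cauchy--Schwarz in time, applied to the probabilities of being in
    \<open>A\<close>.\<close>
  have "real (Suc n) * (real (Suc n) / 4) = (real (Suc n) / 2)\<^sup>2"
    by (simp add: power2_eq_square)
  also have "\<dots> \<le> (\<Sum>t\<le>n. ?a t)\<^sup>2"
    by (rule power_mono[OF occ]) simp
  also have "\<dots> \<le> real (Suc n) * (\<Sum>t\<le>n. (?a t)\<^sup>2)"
    using ineq[of ?a "{..n}"] by simp
  finally have "real (Suc n) / 4 \<le> (\<Sum>t\<le>n. (?a t)\<^sup>2)"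
    by (rule mult_left_le_imp_le) simp
  \<comment> \<open>Cauchy--Schwarz in space: at each time the collision probability is least when
    the mass is spread evenly over \<open>A\<close>.\<close>
  also have "\<dots> \<le> (\<Sum>t\<le>n. real (card A) * (\<Sum>z\<in>A. ((P ^^ t) (indicator {z}) x)\<^sup>2))"
  proof (rule sum_mono)
    fix t
    have "(indicator A :: 's \<Rightarrow> real) = (\<lambda>y. \<Sum>z\<in>A. indicator {z} y)"
      using A(1) by (auto simp: indicator_def fun_eq_iff)
    then have "?a t = (\<Sum>z\<in>A. (P ^^ t) (indicator {z}) x)"
      using A(1) by (simp only: pow_sum)
    then show "(?a t)\<^sup>2 \<le> real (card A) * (\<Sum>z\<in>A. ((P ^^ t) (indicator {z}) x)\<^sup>2)"
      using ineq by simp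
  qed
  also have "\<dots> = real (card A) * ?E n (x, x)"
    by (simp add: pair.expectation_occupation pow sum_distrib_left)
  finally have "real (Suc n) / (4 * real (card A)) \<le> ?E n (x, x)"
    using cA by (simp add: field_simps)
  then have first: "m \<le> ?E n (x, x)" using m by linarith
  show ?thesis
    using paley_zygmund_pmf[OF pair.finite_set_law _ m(1) first second] d0 G by (simp add: mult_ac)
qed

end

section \<open>Combs over a rooted tree\<close>

text \<open>The value of \<open>par root\<close> is left open; hence the guards
  \<open>\<noteq> root\<close> in the definitions of children and edges.\<close>

locale rooted_tree =
  fixes par :: "'h \<Rightarrow> 'h" and root :: 'h and dep :: "'h \<Rightarrow> nat"
  assumes dep_root [simp]: "dep root = 0"
    and dep_par: "w \<noteq> root \<Longrightarrow> dep w = Suc (dep (par w))"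
    and finite_children: "finite {c. c \<noteq> root \<and> par c = w}"
    and card_children: "card {c. c \<noteq> root \<and> par c = w} \<le> 2"
begin

definition children :: "'h \<Rightarrow> 'h set" where "children w = {c. c \<noteq> root \<and> par c = w}"

text \<open>Contains \<open>w\<close> but not the root: each member stands for the edge to its
  parent, so the set encodes the edges of the path from \<open>w\<close> to the root and
  intersections count common edges.\<close>

definition anc :: "'h \<Rightarrow> 'h set" where "anc w = (\<lambda>m. (par ^^ m) w) ` {..<dep w}"

definition overlap :: "'h \<Rightarrow> 'h \<Rightarrow> real" where "overlap y w = real (card (anc y \<inter> anc w))"

definition tedge :: "'h \<Rightarrow> 'h \<Rightarrow> bool" where
  "tedge w z \<longleftrightarrow> (w \<noteq> root \<and> z = par w) \<or> (z \<noteq> root \<and> w = par z)"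

lemma tree_induct [case_names root par]:
  assumes "Q root" "\<And>w. w \<noteq> root \<Longrightarrow> Q (par w) \<Longrightarrow> Q w"
  shows "Q w"
proof (induction "dep w" arbitrary: w rule: less_induct)
  case less
  then show ?case using assms dep_par by (cases "w = root") auto
qed

lemma anc_root [simp]: "anc root = {}"
  by (simp add: anc_def)

lemma anc_par: "w \<noteq> root \<Longrightarrow> anc w = insert w (anc (par w))"
proof -
  assume "w \<noteq> root"
  then have "{..<dep w} = insert 0 (Suc ` {..<dep (par w)})"
    by (simp only: dep_par lessThan_Suc_eq_insert_0 not_False_eq_True)
  then show ?thesis by (simp add: anc_def image_image funpow_swap1)
qed

lemma finite_anc [simp]: "finite (anc w)"
  by (simp add: anc_def)

lemma anc_dep: "z \<in> anc w \<Longrightarrow> z \<noteq> root \<and> dep z \<le> dep w"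
  by (induction w rule: tree_induct) (auto simp: anc_par dep_par)

lemma not_in_anc_par: "w \<noteq> root \<Longrightarrow> w \<notin> anc (par w)"
  using anc_dep[of w "par w"] dep_par[of w] by auto

lemma card_anc: "card (anc w) = dep w"
  by (induction w rule: tree_induct) (auto simp: anc_par dep_par not_in_anc_par)

lemma anc_mono: "q \<in> anc w \<Longrightarrow> anc q \<subseteq> anc w"
  by (induction w rule: tree_induct) (auto simp: anc_par)

lemma overlap_root [simp]: "overlap y root = 0" "overlap root w = 0"
  by (simp_all add: overlap_def)

lemma overlap_nonneg [simp]: "0 \<le> overlap y w"
  by (simp add: overlap_def)

lemma overlap_le: "overlap y w \<le> real (dep y)"
  using card_mono[of "anc y" "anc y \<inter> anc w"] by (simp add: overlap_def card_anc)

lemma overlap_descendant: "q \<in> anc w \<Longrightarrow> overlap q w = real (dep q)"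
  using anc_mono[of q w] by (simp add: overlap_def card_anc Int_absorb2)

lemma overlap_par: "w \<noteq> root \<Longrightarrow> overlap y w = overlap y (par w) + of_bool (w \<in> anc y)"
  by (auto simp: overlap_def anc_par Int_insert_right not_in_anc_par)

text \<open>A vertex on the path from the root to \<open>y\<close>, other than \<open>y\<close>, has
  exactly one child on that path; every other vertex, and \<open>y\<close> itself, has none.\<close>

lemma card_children_anc:
  "real (card (children w \<inter> anc y)) = of_bool (w = root \<or> w \<in> anc y) - of_bool (w = y)"
proof (induction y rule: tree_induct)
  case root
  then show ?case by simp
next
  case (par y)
  have "children w \<inter> anc y = (if par y = w then insert y (children w \<inter> anc (par y)) else children w \<inter> anc (par y))"
    using par(1) by (auto simp: children_def anc_par)
  then have "real (card (children w \<inter> anc y)) = of_bool (par y = w) + real (card (children w \<inter> anc (par y)))"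
    using not_in_anc_par[OF par(1)] by auto
  then show ?case
    using par not_in_anc_par[OF par(1)] by (auto simp: anc_par split: if_splits)
qed

lemma par_neq: "w \<noteq> root \<Longrightarrow> par w \<noteq> w" "w \<noteq> root \<Longrightarrow> par w \<noteq> root \<Longrightarrow> par (par w) \<noteq> w"
  using dep_par[of w] dep_par[of "par w"] by fastforce+

lemma simple_tedge: "simple_graph UNIV tedge"
  using par_neq(1) by (auto simp: simple_graph_def tedge_def) metis

lemma nbrs_tedge: "nbrs tedge w = children w \<union> (if w = root then {} else {par w})"
  by (auto simp: nbrs_def tedge_def children_def)

lemma finite_children_set [simp]: "finite (children w)"
  using finite_children by (simp add: children_def)

lemma par_notin_children: "w \<noteq> root \<Longrightarrow> par w \<notin> children w"
  using par_neq[of w] by (auto simp: children_def)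

lemma finite_nbrs_tedge [simp]: "finite (nbrs tedge w)"
  by (simp add: nbrs_tedge)

lemma card_nbrs_tedge: "card (nbrs tedge w) \<le> 3"
proof -
  have "card (nbrs tedge w) \<le> card (children w) + card (if w = root then {} else {par w})"
    unfolding nbrs_tedge by (rule card_Un_le)
  also have "\<dots> \<le> 2 + 1"
    using card_children[of w] by (intro add_mono) (auto simp: children_def)
  finally show ?thesis by simp
qed

lemma tedge_connected: "graph_connected UNIV tedge"
proof -
  let ?r = "{(a, b). tedge a b}"
  have "(w, root) \<in> ?r\<^sup>* \<and> (root, w) \<in> ?r\<^sup>*" for w
  proof (induction w rule: tree_induct)
    case (par w)
    then have "(w, par w) \<in> ?r" "(par w, w) \<in> ?r" by (auto simp: tedge_def)
    with par show ?case
      by (meson converse_rtrancl_into_rtrancl rtrancl.rtrancl_into_rtrancl)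
  qed simp
  then show ?thesis unfolding graph_connected_def by (meson rtrancl_trans)
qed

text \<open>Along the path to \<open>y\<close> the loss towards the parent cancels the gain towards
  the one child on the path, except at the two ends; off the path \<open>overlap y\<close> is
  locally constant.\<close>

lemma sum_nbrs_overlap:
  "(\<Sum>z\<in>nbrs tedge w. overlap y z - overlap y w) = of_bool (w = root) - of_bool (w = y)"
proof -
  have "(\<Sum>z\<in>children w. overlap y z - overlap y w) = (\<Sum>z\<in>children w. of_bool (z \<in> anc y))"
    by (intro sum.cong) (auto simp: children_def overlap_par)
  also have "\<dots> = real (card (children w \<inter> anc y))"
    by (simp add: of_bool_def sum.If_cases)
  finally have c: "(\<Sum>z\<in>children w. overlap y z - overlap y w)
      = of_bool (w = root \<or> w \<in> anc y) - of_bool (w = y)"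
    by (simp add: card_children_anc)
  show ?thesis
  proof (cases "w = root")
    case False
    then have "(\<Sum>z\<in>nbrs tedge w. overlap y z - overlap y w)
        = (overlap y (par w) - overlap y w) + (\<Sum>z\<in>children w. overlap y z - overlap y w)"
      by (simp add: nbrs_tedge par_notin_children)
    with False c overlap_par[OF False, of y] show ?thesis by simp
  qed (use c in \<open>simp add: nbrs_tedge\<close>)
qed

section \<open>Local times, displacement and Green function of the walk on the comb\<close>

abbreviation comb :: "int \<times> 'h \<Rightarrow> int \<times> 'h \<Rightarrow> bool" where
  "comb \<equiv> comb_edge Z_edge tedge root"

lemma nbrs_comb:
  "nbrs comb (i, w) = Pair i ` nbrs tedge w \<union> (if w = root then {(i - 1, root), (i + 1, root)} else {})"
  by (auto simp: nbrs_def comb_edge_def Z_edge_def)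

lemma sum_nbrs_comb:
  fixes f :: "int \<times> 'h \<Rightarrow> 'b::comm_monoid_add"
  shows "(\<Sum>q\<in>nbrs comb (i, w). f q)
    = (\<Sum>z\<in>nbrs tedge w. f (i, z)) + (if w = root then f (i - 1, root) + f (i + 1, root) else 0)"
proof -
  have "(\<Sum>q\<in>nbrs comb (i, w). f q) = (\<Sum>q\<in>Pair i ` nbrs tedge w. f q)
      + (\<Sum>q\<in>(if w = root then {(i - 1, root), (i + 1, root)} else {}). f q)"
    unfolding nbrs_comb by (rule sum.union_disjoint) auto
  then show ?thesis by (simp add: sum.reindex inj_on_def)
qed

sublocale C: walk_graph comb
proof
  fix s x y :: "int \<times> 'h"
  show "finite (nbrs comb s)" by (cases s) (simp add: nbrs_comb)
  show "nbrs comb s \<noteq> {}" by (cases s) (auto simp: nbrs_comb nbrs_tedge)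
  show "comb x y \<Longrightarrow> comb y x"
    by (auto simp: comb_edge_def Z_edge_def tedge_def)
qed

abbreviation P where "P \<equiv> avg (nbrs comb)"

lemma deg_le: "C.deg x \<le> 5"
proof -
  obtain i w where x: "x = (i, w)" by (cases x)
  have "card (nbrs comb x) = card (nbrs tedge w) + (if w = root then 2 else 0)"
    using sum_nbrs_comb[of "\<lambda>_. 1::nat" i w] by (simp add: x)
  then show ?thesis using card_nbrs_tedge[of w] by (simp add: C.deg_def split: if_splits)
qed

text \<open>Counts expected visits before time \<open>n\<close> to the copies of \<open>y\<close> in
  all teeth. The weight \<open>1 / C.deg p\<close> matches the point masses in the Laplacians of the
  explicit functions.\<close>

definition local_time :: "nat \<Rightarrow> 'h \<Rightarrow> int \<times> 'h \<Rightarrow> real" where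
  "local_time n y x = (\<Sum>t<n. (P ^^ t) (\<lambda>p. of_bool (snd p = y) / C.deg p) x)"

lemma local_time_nonneg: "0 \<le> local_time n y x"
  unfolding local_time_def
  by (intro sum_nonneg C.pow_nonneg) (simp add: less_imp_le)

text \<open>Backbone steps leave \<open>snd\<close> unchanged, so only the tree part contributes to
  the Laplacian, and telescoping applies.\<close>

lemma pow_overlap:
  "(P ^^ n) (\<lambda>p. overlap y (snd p)) x - overlap y (snd x) = local_time n root x - local_time n y x"
proof -
  have "P (\<lambda>p. overlap y (snd p)) p - overlap y (snd p)
      = of_bool (snd p = root) / C.deg p - of_bool (snd p = y) / C.deg p" for p
  proof -
    obtain i w where p: "p = (i, w)" by (cases p)
    show ?thesis
      unfolding C.avg_minus_self[of "\<lambda>p. overlap y (snd p)"] unfolding p sum_nbrs_comb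
      by (simp add: sum_nbrs_overlap diff_divide_distrib)
  qed
  from C.pow_telescope[of "\<lambda>p. overlap y (snd p)", OF this] show ?thesis
    by (simp only: local_time_def C.pow_diff sum_subtractf)
qed

text \<open>Since \<open>overlap y\<close> lies between 0 and \<open>dep y\<close>, each
  \<open>y\<close> in \<open>A\<close> has at least the local time of the root minus
  \<open>R\<close>. Together the vertices of \<open>A\<close> cannot receive more than
  \<open>n\<close>.\<close>

lemma local_time_root_le:
  assumes "finite A" "A \<noteq> {}" and R: "\<And>y. y \<in> A \<Longrightarrow> dep y \<le> R"
  shows "local_time n root x \<le> real n / real (card A) + real R"
proof -
  have deg1: "1 \<le> C.deg u" for u
    using C.card_nb_pos(1)[of u] unfolding C.deg_def by linarith
  have "real (card A) * (local_time n root x - real R) = (\<Sum>y\<in>A. local_time n root x - real R)"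
    by simp
  also have "\<dots> \<le> (\<Sum>y\<in>A. local_time n y x)"
  proof (rule sum_mono)
    fix y assume "y \<in> A"
    have "(P ^^ n) (\<lambda>p. overlap y (snd p)) x \<le> real (dep y)"
      by (rule C.pow_le_const) (rule overlap_le)
    then show "local_time n root x - real R \<le> local_time n y x"
      using pow_overlap[of n y x] R[OF \<open>y \<in> A\<close>] overlap_nonneg[of y "snd x"] by linarith
  qed
  also have "\<dots> = (\<Sum>t<n. (P ^^ t) (\<lambda>p. \<Sum>y\<in>A. of_bool (snd p = y) / C.deg p) x)"
    unfolding local_time_def by (subst sum.swap) (simp add: C.pow_sum assms(1))
  also have "\<dots> \<le> (\<Sum>t<n. 1)"
  proof (intro sum_mono C.pow_le_const)
    fix p :: "int \<times> 'h"
    have "(\<Sum>y\<in>A. of_bool (snd p = y) / C.deg p) = of_bool (snd p \<in> A) / C.deg p"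
      using assms(1) by (simp add: of_bool_def sum_divide_distrib[symmetric])
    also have "\<dots> \<le> 1" using deg1[of p] by (simp add: divide_le_eq)
    finally show "(\<Sum>y\<in>A. of_bool (snd p = y) / C.deg p) \<le> 1" .
  qed
  finally have "real (card A) * (local_time n root x - real R) \<le> real n" by simp
  moreover have "0 < real (card A)" using assms by (simp add: card_gt_0_iff)
  ultimately have "local_time n root x - real R \<le> real n / real (card A)"
    by (simp add: le_divide_eq mult.commute)
  then show ?thesis by simp
qed

lemma local_time_le_root: "local_time n y (j, root) \<le> local_time n root (j, root)"
proof -
  have "0 \<le> (P ^^ n) (\<lambda>p. overlap y (snd p)) (j, root)"
    by (rule C.pow_nonneg) simp
  then show ?thesis using pow_overlap[of n y "(j, root)"] by simp
qed

text \<open>The first coordinate changes only on the backbone, where each of the two unit steps has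
  probability \<open>1 / C.deg p\<close>.\<close>

lemma pow_square_displacement:
  "(P ^^ n) (\<lambda>p. (real_of_int (fst p - j))\<^sup>2) x - (real_of_int (fst x - j))\<^sup>2 = 2 * local_time n root x"
proof -
  have "P (\<lambda>p. (real_of_int (fst p - j))\<^sup>2) p - (real_of_int (fst p - j))\<^sup>2
      = 2 * (of_bool (snd p = root) / C.deg p)" for p
  proof -
    obtain i w where p: "p = (i, w)" by (cases p)
    show ?thesis
      unfolding C.avg_minus_self[of "\<lambda>p. (real_of_int (fst p - j))\<^sup>2"] unfolding p sum_nbrs_comb
      by (simp add: power2_eq_square algebra_simps)
  qed
  from C.pow_telescope[of "\<lambda>p. (real_of_int (fst p - j))\<^sup>2", OF this] show ?thesis
    by (simp only: local_time_def C.pow_cmult sum_distrib_left)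
qed

text \<open>The function \<open>h\<close> below is the potential kernel of the comb with pole \<open>x\<close>: on the tooth of
  \<open>x\<close> it is the potential of a unit current flowing from \<open>x\<close> to the backbone, on the backbone
  the one-dimensional potential kernel.\<close>

lemma green_le:
  assumes K: "0 < K"
  shows "(\<Sum>t<n. (P ^^ t) (indicator {(j, y)}) (j, y))
    \<le> 5 * (real (dep y) + (2 * local_time n root (j, y) / K + K) / 4)"
proof -
  let ?x = "(j, y)"
  let ?W = "real (dep y) + (2 * local_time n root ?x / K + K) / 4"
  let ?h = "\<lambda>p. of_bool (fst p = j) * overlap y (snd p) - \<bar>real_of_int (fst p - j)\<bar> / 2"
  define h where "h = ?h"
  have "P ?h p - ?h p = (- 1 / C.deg ?x) * indicator {?x} p" for p
  proof -
    obtain i w where p: "p = (i, w)" by (cases p)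
    have tooth: "(\<Sum>z\<in>nbrs tedge w. ?h (i, z) - ?h (i, w))
        = of_bool (i = j) * (of_bool (w = root) - of_bool (w = y))"
      unfolding sum_nbrs_overlap[symmetric] by simp
    \<comment> \<open>The kink of the absolute value at \<open>j\<close> cancels the mass that
      \<open>overlap y\<close> leaves at the root of the tooth over \<open>j\<close>.\<close>
    have bone: "(?h (i - 1, root) - ?h (i, root)) + (?h (i + 1, root) - ?h (i, root)) = - of_bool (i = j)"
      by (cases i j rule: linorder_cases) (simp_all add: abs_if field_simps)
    have "(\<Sum>q\<in>nbrs comb p. ?h q - ?h p) = - indicator {?x} p"
      unfolding p sum_nbrs_comb tooth using bone by (auto simp: indicator_def)
    then show ?thesis
      unfolding C.avg_minus_self[of ?h] by (auto simp: indicator_def)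
  qed
  then have lap: "P h p - h p = (- 1 / C.deg ?x) * indicator {?x} p" for p
    unfolding h_def .
  have "(P ^^ n) h ?x - h ?x = (- 1 / C.deg ?x) * (\<Sum>t<n. (P ^^ t) (indicator {?x}) ?x)"
    using C.pow_telescope[of h, OF lap] by (simp only: C.pow_cmult sum_distrib_left)
  then have "(\<Sum>t<n. (P ^^ t) (indicator {?x}) ?x) = C.deg ?x * (h ?x - (P ^^ n) h ?x)"
    by (simp add: field_simps)
  also have "\<dots> \<le> C.deg ?x * ?W"
  proof (rule mult_left_mono)
    have "- (P ^^ n) h ?x = (P ^^ n) (\<lambda>p. (-1) * h p) ?x"
      using C.pow_cmult[of n "-1" h ?x] by simp
    also have "\<dots> \<le> (P ^^ n) (\<lambda>p. (1 / (4 * K)) * (real_of_int (fst p - j))\<^sup>2 + K / 4) ?x"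
    proof (rule C.pow_mono)
      fix p :: "int \<times> 'h"
      define a where "a = \<bar>real_of_int (fst p - j)\<bar>"
      define b where "b = of_bool (fst p = j) * overlap y (snd p)"
      have "0 \<le> (a - K)\<^sup>2" by simp
      \<comment> \<open>This replaces the distance by its square, whose expectation is known through
        the local time of the root; the free parameter \<open>K\<close> balances the two
        terms.\<close>
      then have "a / 2 \<le> (1 / (4 * K)) * a\<^sup>2 + K / 4"
        using K by (simp add: field_simps power2_eq_square)
      moreover have "0 \<le> b" by (simp add: b_def)
      ultimately have "(-1) * (b - a / 2) \<le> (1 / (4 * K)) * a\<^sup>2 + K / 4" by argo
      then show "(-1) * h p \<le> (1 / (4 * K)) * (real_of_int (fst p - j))\<^sup>2 + K / 4"
        by (simp only: h_def a_def b_def power2_abs)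
    qed
    also have "\<dots> = (1 / (4 * K)) * (P ^^ n) (\<lambda>p. (real_of_int (fst p - j))\<^sup>2) ?x + K / 4"
      by (simp only: C.pow_add C.pow_cmult C.pow_const)
    also have "(P ^^ n) (\<lambda>p. (real_of_int (fst p - j))\<^sup>2) ?x = 2 * local_time n root ?x"
      using pow_square_displacement[of n j ?x] by simp
    also have "(1 / (4 * K)) * (2 * local_time n root ?x) + K / 4 = (2 * local_time n root ?x / K + K) / 4"
      using K by (simp add: field_simps)
    finally have "- (P ^^ n) h ?x \<le> (2 * local_time n root ?x / K + K) / 4" .
    moreover have "h ?x \<le> real (dep y)" using overlap_le[of y y] by (simp add: h_def)
    ultimately show "h ?x - (P ^^ n) h ?x \<le> ?W" by linarith
  qed (simp add: less_imp_le)
  also have "\<dots> \<le> 5 * ?W"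
    using K local_time_nonneg[of n root ?x] by (intro mult_right_mono deg_le) simp
  finally show ?thesis .
qed

end

section \<open>Many collisions at a single scale\<close>

context rooted_tree
begin

text \<open>The shallow part is \<open>A\<close>, the bare segment is \<open>S\<close>, and every
  remaining vertex lies at or beyond the bottleneck \<open>q\<close>. Three small losses keep the
  walk in a box over \<open>A\<close> for half of the time, and \<open>many_collisions\<close>
  applies to that box.\<close>

lemma collisions_at_scale:
  assumes R: "1 \<le> R" and A: "finite A" "A \<noteq> {}" "\<And>y. y \<in> A \<Longrightarrow> dep y \<le> R"
    and S: "finite S" "80 * card S \<le> card A"
    and q: "16 * R\<^sup>2 \<le> dep q" and cover: "\<And>w. w \<in> A \<or> w \<in> S \<or> q \<in> anc w"
  shows "\<exists>n. 1 / 20160 \<le> measure_pmf.prob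
      (paths (\<lambda>s. pmf_of_set (C.nbrs2 s)) n ((0, root), (0, root)))
      {p. real R / 72 \<le> occupation {(y, y) |y. True} p}"
proof -
  let ?o = "(0::int, root)"
  \<comment> \<open>The mean square displacement will be at most \<open>4 * R\<^sup>2\<close>, so by
    Chebyshev a half-width of \<open>4 * R\<close> is exceeded with probability at most 1/4.\<close>
  let ?D = "{- 4 * int R..4 * int R} \<times> A"
  \<comment> \<open>At this time scale the local time of the root is at most
    \<open>R\<^sup>2 + R\<close>. Sums over \<open>t \<le> n\<close> have exactly \<open>T\<close>
    terms.\<close>
  define T where "T = card A * R\<^sup>2"
  define n where "n = T - 1"
  have cA: "0 < card A" using A by (simp add: card_gt_0_iff)
  then have T: "Suc n = T" using R by (simp add: n_def T_def)
  have R1: "1 \<le> real R" using R by simp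
  then have R2: "real R \<le> (real R)\<^sup>2" by (simp add: power2_eq_square)
  have root_le: "local_time t root x \<le> real k * (real R)\<^sup>2 + real R" if "t \<le> k * T" for t k x
  proof -
    have "real t \<le> real k * (real R)\<^sup>2 * real (card A)"
      using that unfolding T_def by (simp add: mult_ac flip: of_nat_mult of_nat_power)
    then have "real t / real (card A) \<le> real k * (real R)\<^sup>2"
      using cA by (simp add: divide_le_eq)
    then show ?thesis
      using local_time_root_le[OF A, of t x] by linarith
  qed
  have root_le1: "local_time t root ?o \<le> 2 * (real R)\<^sup>2" if "t \<le> T" for t
  proof -
    have "local_time t root ?o \<le> (real R)\<^sup>2 + real R"
      using root_le[of t 1 ?o] that by simp
    with R2 show ?thesis by linarith
  qed
  \<comment> \<open>With \<open>K = R\<close> in \<open>green_le\<close> the bound is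
    \<open>5 * (R + (6 * R + R) / 4)\<close>, that is 13.75 times \<open>R\<close>.\<close>
  have G: "(\<Sum>t\<le>2 * n. (P ^^ t) (indicator {x}) x) \<le> 14 * real R" if xD: "x \<in> ?D" for x
  proof -
    obtain j y where x: "x = (j, y)" "y \<in> A" using xD by auto
    have "local_time (Suc (2 * n)) root x \<le> 3 * (real R)\<^sup>2"
    proof -
      have "Suc (2 * n) \<le> 2 * T" using T by linarith
      from root_le[OF this, of x] have "local_time (Suc (2 * n)) root x \<le> 2 * (real R)\<^sup>2 + real R"
        by simp
      with R2 show ?thesis by linarith
    qed
    then have "2 * local_time (Suc (2 * n)) root x / real R \<le> 6 * real R"
      using R1 by (simp add: divide_le_eq power2_eq_square)
    moreover have "real (dep y) \<le> real R" using A(3)[OF x(2)] by simp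
    ultimately show ?thesis
      using green_le[where K = "real R" and n = "Suc (2 * n)" and j = j and y = y] R1 unfolding x(1) lessThan_Suc_atMost by argo
  qed
  have ell: "16 * (real R)\<^sup>2 \<le> real (dep q)"
    using q by (metis of_nat_le_iff of_nat_mult of_nat_numeral of_nat_power)
  have ell0: "0 < real (dep q)" using ell R1 by (smt (verit) R2)
  \<comment> \<open>A union bound with functions: large displacement, membership in \<open>S\<close>
    and passage beyond \<open>q\<close> are each dominated by a function whose expectation is under
    control.\<close>
  have outside: "1 - (real_of_int (fst p - 0))\<^sup>2 / (16 * (real R)\<^sup>2) - of_bool (snd p \<in> S)
      - overlap q (snd p) / real (dep q) \<le> indicator ?D p" for p
  proof -
    obtain i w where p: "p = (i, w)" by (cases p)
    define u v where "u = (real_of_int i)\<^sup>2 / (16 * (real R)\<^sup>2)" and "v = overlap q w / real (dep q)"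
    have "0 \<le> u" "0 \<le> v" by (simp_all add: u_def v_def)
    moreover have "1 \<le> u" if "4 * int R < \<bar>i\<bar>"
    proof -
      have "4 * real R \<le> \<bar>real_of_int i\<bar>" using that by linarith
      then have "(4 * real R)\<^sup>2 \<le> \<bar>real_of_int i\<bar>\<^sup>2" by (rule power_mono) simp
      then show ?thesis
        using R1 by (simp add: u_def power_mult_distrib)
    qed
    moreover have "v = 1" if "q \<in> anc w"
      using that ell0 by (simp add: v_def overlap_descendant)
    moreover have "w \<in> S \<or> q \<in> anc w \<or> 4 * int R < \<bar>i\<bar> \<or> p \<in> ?D"
      using cover[of w] p by force
    ultimately have "1 - u - of_bool (w \<in> S) - v \<le> indicator ?D p"
      by (cases "p \<in> ?D") (auto simp: of_bool_def)
    then show ?thesis by (simp add: p u_def v_def)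
  qed
  \<comment> \<open>The displacement costs 1/4 and the passage beyond \<open>q\<close> costs
    1/8.\<close>
  have step: "5 / 8 - (P ^^ t) (\<lambda>p. of_bool (snd p \<in> S)) ?o \<le> (P ^^ t) (indicator ?D) ?o"
    if t: "t \<le> n" for t
  proof -
    have "t \<le> T" using t T by simp
    note L = root_le1[OF this]
    have "(P ^^ t) (\<lambda>p. (1 - (1 / (16 * (real R)\<^sup>2)) * (real_of_int (fst p - 0))\<^sup>2 - of_bool (snd p \<in> S))
        - (1 / real (dep q)) * overlap q (snd p)) ?o \<le> (P ^^ t) (indicator ?D) ?o"
      by (rule C.pow_mono) (use outside in simp)
    moreover have "(P ^^ t) (\<lambda>p. (1 - (1 / (16 * (real R)\<^sup>2)) * (real_of_int (fst p - 0))\<^sup>2 - of_bool (snd p \<in> S))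
        - (1 / real (dep q)) * overlap q (snd p)) ?o
      = 1 - (1 / (16 * (real R)\<^sup>2)) * (P ^^ t) (\<lambda>p. (real_of_int (fst p - 0))\<^sup>2) ?o
        - (P ^^ t) (\<lambda>p. of_bool (snd p \<in> S)) ?o - (1 / real (dep q)) * (P ^^ t) (\<lambda>p. overlap q (snd p)) ?o"
      by (simp only: C.pow_diff C.pow_cmult C.pow_const)
    moreover have "(1 / (16 * (real R)\<^sup>2)) * (P ^^ t) (\<lambda>p. (real_of_int (fst p - 0))\<^sup>2) ?o \<le> 1 / 4"
    proof -
      have "(P ^^ t) (\<lambda>p. (real_of_int (fst p - 0))\<^sup>2) ?o = 2 * local_time t root ?o"
        using pow_square_displacement[of t 0 ?o] by simp
      then show ?thesis using L R1 by (simp add: divide_le_eq)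
    qed
    moreover have "(1 / real (dep q)) * (P ^^ t) (\<lambda>p. overlap q (snd p)) ?o \<le> 1 / 8"
    proof -
      have "(P ^^ t) (\<lambda>p. overlap q (snd p)) ?o \<le> 2 * (real R)\<^sup>2"
        using pow_overlap[of t q ?o] local_time_nonneg[of t q ?o] L by simp
      then have "8 * (P ^^ t) (\<lambda>p. overlap q (snd p)) ?o \<le> real (dep q)"
        using ell by linarith
      then show ?thesis using ell0 by (simp add: divide_le_eq)
    qed
    ultimately show ?thesis by linarith
  qed
  \<comment> \<open>The factor 5 bounding the degree undoes the weight in \<open>local_time\<close>,
    and each vertex of \<open>S\<close> has local time at most \<open>2 * R\<^sup>2\<close>. Since
    \<open>80 = 8 * 5 * 2\<close>, the loss is 1/8 of the time, leaving the required half.\<close>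
  have inS: "(\<Sum>t\<le>n. (P ^^ t) (\<lambda>p. of_bool (snd p \<in> S)) ?o) \<le> real T / 8"
  proof -
    have "(\<Sum>t\<le>n. (P ^^ t) (\<lambda>p. of_bool (snd p \<in> S)) ?o)
        \<le> (\<Sum>t\<le>n. (P ^^ t) (\<lambda>p. \<Sum>y\<in>S. 5 * (of_bool (snd p = y) / C.deg p)) ?o)"
    proof (intro sum_mono C.pow_mono)
      fix p :: "int \<times> 'h"
      have "(\<Sum>y\<in>S. 5 * (of_bool (snd p = y) / C.deg p)) = 5 * (of_bool (snd p \<in> S) / C.deg p)"
        using S(1) by (simp add: of_bool_def sum_divide_distrib[symmetric] sum_distrib_left[symmetric])
      then show "of_bool (snd p \<in> S) \<le> (\<Sum>y\<in>S. 5 * (of_bool (snd p = y) / C.deg p))"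
        using deg_le[of p] by (simp add: le_divide_eq)
    qed
    also have "\<dots> = (\<Sum>y\<in>S. 5 * local_time T y ?o)"
      unfolding local_time_def T[symmetric] lessThan_Suc_atMost sum_distrib_left
      by (subst sum.swap) (simp only: C.pow_sum[OF S(1)] C.pow_cmult)
    also have "\<dots> \<le> (\<Sum>y\<in>S. 5 * (2 * (real R)\<^sup>2))"
      by (intro sum_mono mult_left_mono order_trans[OF local_time_le_root root_le1]) simp_all
    also have "\<dots> = (80 * real (card S)) * (real R)\<^sup>2 / 8" by simp
    also have "\<dots> \<le> real (card A) * (real R)\<^sup>2 / 8"
      using S(2) by (intro divide_right_mono mult_right_mono) (simp_all flip: of_nat_mult)
    finally show ?thesis by (simp add: T_def)
  qed
  have occ: "real (Suc n) / 2 \<le> (\<Sum>t\<le>n. (P ^^ t) (indicator ?D) ?o)"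
  proof -
    have "(\<Sum>t\<le>n. 5 / 8 - (P ^^ t) (\<lambda>p. of_bool (snd p \<in> S)) ?o) \<le> (\<Sum>t\<le>n. (P ^^ t) (indicator ?D) ?o)"
      by (rule sum_mono) (use step in simp)
    then have "real (Suc n) * (5 / 8) - (\<Sum>t\<le>n. (P ^^ t) (\<lambda>p. of_bool (snd p \<in> S)) ?o)
        \<le> (\<Sum>t\<le>n. (P ^^ t) (indicator ?D) ?o)"
      by (simp only: sum_subtractf sum_constant card_atMost)
    then show ?thesis using inS unfolding T by linarith
  qed
  have D: "finite ?D" "?D \<noteq> {}" using A by auto
  have "real (card ?D) = (8 * real R + 1) * real (card A)"
    by (simp add: card_cartesian_product)
  also have "\<dots> \<le> 9 * real R * real (card A)"
    using R1 by (intro mult_right_mono) auto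
  finally have cD: "real (card ?D) \<le> 9 * real R * real (card A)" .
  have cD0: "0 < real (card ?D)" using D by (simp only: of_nat_0_less_iff card_gt_0_iff) simp
  have "real R / 36 * (4 * real (card ?D)) \<le> real R / 36 * (4 * (9 * real R * real (card A)))"
    using cD by (intro mult_left_mono) auto
  also have "\<dots> = real (Suc n)"
    unfolding T by (simp add: T_def power2_eq_square)
  finally have m: "real R / 36 \<le> real (Suc n) / (4 * real (card ?D))"
    using cD0 by (simp add: le_divide_eq)
  \<comment> \<open>Here \<open>m = R / 36\<close>, \<open>d = 5\<close> and
    \<open>G = 14 * R\<close>, so \<open>R\<close> cancels and
    \<open>36 * 8 * 5 * 14 = 20160\<close> remains.\<close>
  have "real R / 36 / (8 * 5 * (14 * real R)) \<le> measure_pmf.prob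
      (paths (\<lambda>s. pmf_of_set (C.nbrs2 s)) n (?o, ?o))
      {p. real R / 36 / 2 \<le> occupation {(y, y) |y. y \<in> ?D} p}"
    by (rule C.many_collisions[OF D deg_le _ occ G _ m]) (use R1 in auto)
  also have "\<dots> \<le> measure_pmf.prob (paths (\<lambda>s. pmf_of_set (C.nbrs2 s)) n (?o, ?o))
      {p. real R / 72 \<le> occupation {(y, y) |y. True} p}"
  proof (rule measure_pmf.finite_measure_mono)
    have "occupation {(y, y) |y. y \<in> ?D} p \<le> occupation {(y, y) |y. True} p" for p
      unfolding occupation_def by (rule sum_list_mono) (auto simp: indicator_def)
    then show "{p. real R / 36 / 2 \<le> occupation {(y, y) |y. y \<in> ?D} p}
        \<subseteq> {p. real R / 72 \<le> occupation {(y, y) |y. True} p}"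
      by (force intro: order_trans)
  qed simp
  finally show ?thesis using R1 by (intro exI[of _ n]) simp
qed

end

section \<open>From finite paths to infinitely many collisions\<close>

lemma (in walk_graph) pmf_paths_pair:
  assumes "length p = Suc n" "length q = Suc n"
  shows "pmf (paths (\<lambda>s. pmf_of_set (nbrs2 s)) n (x, y)) (zip p q) = srw_path_prob E x p * srw_path_prob E y q"
proof -
  have "pmf (pmf_of_set (nbrs E a \<times> nbrs E b)) (c, d)
      = (if E a c then 1 / real (card (nbrs E a)) else 0)
      * (if E b d then 1 / real (card (nbrs E b)) else 0)" for a b c d
  proof -
    have "c \<in> nbrs E a \<longleftrightarrow> E a c" "d \<in> nbrs E b \<longleftrightarrow> E b d" by (simp_all add: nbrs_def)
    then show ?thesis
      by (subst pmf_of_set) (simp_all add: indicator_def card_cartesian_product)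
  qed
  then show ?thesis
    using assms by (simp add: pmf_paths srw_path_prob_def prod.distrib)
qed

text \<open>The events \<open>U m\<close> of at least \<open>m\<close> collisions decrease in
  \<open>m\<close> and all have probability at least \<open>c\<close>. By continuity from above so
  does their intersection, which is disjoint from the event of finitely many collisions.\<close>

theorem not_finite_collision_property:
  fixes E :: "'s::countable \<Rightarrow> 's \<Rightarrow> bool"
  assumes "walk_graph E" and x: "x \<in> V" and c: "0 < c"
    and many: "\<And>m::nat. \<exists>n. c \<le> measure_pmf.prob
      (paths (\<lambda>s. pmf_of_set ((\<lambda>(x, y). nbrs E x \<times> nbrs E y) s)) n (x, x))
      {p. real m \<le> occupation {(y, y) |y. True} p}"
  shows "\<not> finite_collision_property V E"
proof
  assume fcp: "finite_collision_property V E"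
  interpret walk_graph E by (rule assms)
  let ?D = "{(y, y) |y :: 's. True}"
  let ?X = "\<lambda>t (\<omega> :: nat \<Rightarrow> 's \<times> 's). fst (\<omega> t)" and ?Y = "\<lambda>t (\<omega> :: nat \<Rightarrow> 's \<times> 's). snd (\<omega> t)"
  obtain M :: "(nat \<Rightarrow> 's \<times> 's) measure" where M: "prob_space M"
    and coord: "\<And>t. (\<lambda>\<omega>. \<omega> t) \<in> M \<rightarrow>\<^sub>M count_space UNIV"
    and map: "\<And>ts. (\<lambda>\<omega>. map \<omega> ts) \<in> M \<rightarrow>\<^sub>M count_space UNIV"
    and law: "\<And>n. distr M (count_space UNIV) (\<lambda>\<omega>. map \<omega> [0..<Suc n])
      = measure_pmf (paths (\<lambda>s. pmf_of_set (nbrs2 s)) n (x, x))"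
    by (rule markov_chain_exists[of "\<lambda>s. pmf_of_set (nbrs2 s)" "(x, x)"]) blast
  interpret prob_space M by (rule M)
  have prob_map: "prob ((\<lambda>\<omega>. map \<omega> [0..<Suc n]) -` B \<inter> space M)
      = measure_pmf.prob (paths (\<lambda>s. pmf_of_set (nbrs2 s)) n (x, x)) B" for n B
    unfolding law[symmetric] by (rule measure_distr[OF map, symmetric]) simp
  have "indep_srws M V E x x ?X ?Y"
    unfolding indep_srws_def
  proof (intro conjI allI impI M x)
    fix t
    show "?X t \<in> M \<rightarrow>\<^sub>M count_space UNIV" "?Y t \<in> M \<rightarrow>\<^sub>M count_space UNIV"
      using measurable_compose[OF coord[of t], of fst "count_space UNIV"]
        measurable_compose[OF coord[of t], of snd "count_space UNIV"] by simp_all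
  next
    fix n and p q :: "'s list"
    assume pq: "length p = Suc n" "length q = Suc n"
    have "{\<omega> \<in> space M. \<forall>i\<le>n. ?X i \<omega> = p ! i \<and> ?Y i \<omega> = q ! i}
        = (\<lambda>\<omega>. map \<omega> [0..<Suc n]) -` {zip p q} \<inter> space M"
      using pq by (auto simp: list_eq_iff_nth_eq less_Suc_eq_le prod_eq_iff simp del: upt_Suc)
    then show "measure M {\<omega> \<in> space M. \<forall>i\<le>n. ?X i \<omega> = p ! i \<and> ?Y i \<omega> = q ! i}
        = srw_path_prob E x p * srw_path_prob E x q"
      using pmf_paths_pair[OF pq, of x x] by (simp add: prob_map measure_pmf_single del: upt_Suc)
  qed
  then have AE: "AE \<omega> in M. finite {t. ?X t \<omega> = ?Y t \<omega>}"
    using fcp unfolding finite_collision_property_def by blast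
  define B where "B m n = (\<lambda>\<omega>. map \<omega> [0..<Suc n]) -` {p. real m \<le> occupation ?D p} \<inter> space M" for m n
  define U where "U m = (\<Union>n. B m n)" for m
  have B: "B m n \<in> events" for m n
    unfolding B_def by (rule measurable_sets[OF map]) simp
  then have U: "U m \<in> events" for m
    unfolding U_def by blast
  have "c \<le> prob (U m)" for m
  proof -
    obtain n where "c \<le> prob (B m n)"
      using many[of m] unfolding B_def prob_map by blast
    also have "\<dots> \<le> prob (U m)"
      by (rule finite_measure_mono[OF _ U]) (auto simp: U_def)
    finally show ?thesis .
  qed
  moreover have "(\<lambda>m. prob (U m)) \<longlonglongrightarrow> prob (\<Inter>m. U m)"
  proof (rule finite_Lim_measure_decseq)
    show "range U \<subseteq> events" using U by auto
    show "decseq U"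
      unfolding decseq_def U_def B_def by (fastforce intro: order_trans[OF of_nat_mono])
  qed
  ultimately have "c \<le> prob (\<Inter>m. U m)"
    by (intro LIMSEQ_le_const) auto
  moreover have "AE \<omega> in M. \<omega> \<notin> (\<Inter>m. U m)"
  proof (rule AE_mp[OF AE], rule AE_I2, rule impI)
    fix \<omega> assume fin: "finite {t. ?X t \<omega> = ?Y t \<omega>}"
    let ?k = "card {t. ?X t \<omega> = ?Y t \<omega>}"
    have "\<not> real (Suc ?k) \<le> occupation ?D (map \<omega> [0..<Suc n])" for n
    proof -
      have "{i. i < length (map \<omega> [0..<Suc n]) \<and> map \<omega> [0..<Suc n] ! i \<in> ?D}
          \<subseteq> {t. ?X t \<omega> = ?Y t \<omega>}"
        by (auto simp del: upt_Suc)
      from card_mono[OF fin this] show ?thesis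
        unfolding occupation_eq_card by linarith
    qed
    then have "\<omega> \<notin> U (Suc ?k)" by (simp add: U_def B_def del: upt_Suc of_nat_Suc)
    then show "\<omega> \<notin> (\<Inter>m. U m)" by blast
  qed
  then have "prob (\<Inter>m. U m) = 0"
    by (subst prob_eq_0) (use U in auto)
  ultimately show False using c by simp
qed

theorem comb_of_tree_not_finite_collision:
  fixes par :: "'h::countable \<Rightarrow> 'h" and root :: 'h and dep :: "'h \<Rightarrow> nat"
  assumes "rooted_tree par root dep"
    and scales: "\<And>r. \<exists>R A S q. r \<le> R \<and> finite A \<and> A \<noteq> {} \<and> (\<forall>y\<in>A. dep y \<le> R) \<and>
      finite S \<and> 80 * card S \<le> card A \<and> 16 * R\<^sup>2 \<le> dep q \<and>
      (\<forall>w. w \<in> A \<or> w \<in> S \<or> q \<in> rooted_tree.anc par dep w)"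
  shows "\<not> finite_collision_property (comb_vertices UNIV UNIV)
    (comb_edge Z_edge (rooted_tree.tedge par root) root)"
proof -
  interpret rooted_tree par root dep by (rule assms)
  show ?thesis
  proof (rule not_finite_collision_property[where c = "1 / 20160" and x = "(0, root)"])
    show "walk_graph comb" by (rule C.walk_graph_axioms)
    show "(0, root) \<in> comb_vertices UNIV UNIV" by (simp add: comb_vertices_def)
    fix m :: nat
    \<comment> \<open>At this scale the number of collisions reaches \<open>R / 72\<close>, hence
      the demand that \<open>R\<close> be at least \<open>72 * m\<close>.\<close>
    obtain R A S q where *: "max 1 (72 * m) \<le> R" "finite A" "A \<noteq> {}" "\<And>y. y \<in> A \<Longrightarrow> dep y \<le> R"
        "finite S" "80 * card S \<le> card A" "16 * R\<^sup>2 \<le> dep q"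
        "\<And>w. w \<in> A \<or> w \<in> S \<or> q \<in> anc w"
      using scales[of "max 1 (72 * m)"] by blast
    then have "1 \<le> R" by simp
    from collisions_at_scale[OF this *(2-)] obtain n where
      "1 / 20160 \<le> measure_pmf.prob (paths (\<lambda>s. pmf_of_set (C.nbrs2 s)) n ((0, root), (0, root)))
        {p. real R / 72 \<le> occupation {(y, y) |y. True} p}" by blast
    also have "\<dots> \<le> measure_pmf.prob (paths (\<lambda>s. pmf_of_set (C.nbrs2 s)) n ((0, root), (0, root)))
        {p. real m \<le> occupation {(y, y) |y. True} p}"
      by (rule measure_pmf.finite_measure_mono) (use *(1) in auto)
    finally show "\<exists>n. 1 / 20160 \<le> measure_pmf.prob
        (paths (\<lambda>s. pmf_of_set (C.nbrs2 s)) n ((0, root), (0, root)))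
        {p. real m \<le> occupation {(y, y) |y. True} p}" by blast
  qed simp
qed

section \<open>The tree\<close>

text \<open>The vertex \<open>(d, j)\<close> is the \<open>j\<close>-th vertex of depth \<open>d\<close>, the ray being \<open>j = 0\<close>.\<close>

primrec onset :: "nat \<Rightarrow> nat" where
  "onset 0 = 32"
| "onset (Suc k) = 64 * (onset k)\<^sup>2"

text \<open>The binary tree attached at height \<open>onset k\<close> fills
  \<open>2 ^ (d - onset k)\<close> positions at depth \<open>d\<close>; its leftmost branch is the
  ray itself.\<close>

definition nodes :: "(nat \<times> nat) set" where
  "nodes = {(d, j). j = 0 \<or> (\<exists>k. onset k \<le> d \<and> d \<le> 2 * onset k \<and> j < 2 ^ (d - onset k))}"

text \<open>Since \<open>nodes\<close> is countably infinite, these are inverse bijections with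
  \<open>nat\<close>, and the graph can have \<open>UNIV\<close> as its vertex set.\<close>

definition dec :: "nat \<Rightarrow> nat \<times> nat" where "dec = from_nat_into nodes"
definition enc :: "nat \<times> nat \<Rightarrow> nat" where "enc = to_nat_on nodes"

text \<open>Halving the position is the parent map of a binary tree and fixes position 0, so one
  formula serves the attached trees and the ray.\<close>

definition up :: "nat \<Rightarrow> nat" where
  "up n = enc (fst (dec n) - 1, snd (dec n) div 2)"

section \<open>The shape of the tree and its scales\<close>

lemma onset_ge: "32 \<le> onset k" "k \<le> onset k"
proof (induction k)
  case (Suc k)
  have "1 * onset k \<le> 64 * (onset k * onset k)"
    using Suc by (intro mult_mono) auto
  then show "32 \<le> onset (Suc k)" using Suc by (simp add: power2_eq_square)
  have "2 * onset k \<le> (64 * onset k) * onset k"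
    using Suc by (intro mult_right_mono) auto
  also have "\<dots> = onset (Suc k)" by (simp add: power2_eq_square)
  finally show "Suc k \<le> onset (Suc k)" using Suc by linarith
qed simp_all

lemma incseq_onset: "incseq onset"
proof (rule incseq_SucI)
  fix k
  have "1 * onset k \<le> (64 * onset k) * onset k"
    using onset_ge(1)[of k] by (intro mult_right_mono) auto
  then show "onset k \<le> onset (Suc k)" by (simp add: power2_eq_square)
qed

lemma infinite_nodes: "infinite nodes"
proof -
  have "range (\<lambda>d::nat. (d, 0::nat)) \<subseteq> nodes" by (auto simp: nodes_def)
  moreover have "infinite (range (\<lambda>d::nat. (d, 0::nat)))"
    by (rule range_inj_infinite) (simp add: inj_on_def)
  ultimately show ?thesis by (rule infinite_super)
qed

lemma dec_in_nodes [simp]: "dec n \<in> nodes"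
  unfolding dec_def by (rule from_nat_into) (use infinite_nodes in auto)

lemma dec_enc [simp]: "x \<in> nodes \<Longrightarrow> dec (enc x) = x"
  by (simp add: dec_def enc_def countableI_type)

lemma enc_dec [simp]: "enc (dec n) = n"
  by (simp add: dec_def enc_def countableI_type infinite_nodes to_nat_on_from_nat_into_infinite)

lemma spine_in_nodes [simp]: "(d, 0) \<in> nodes"
  by (simp add: nodes_def)

lemma nodes_Suc: "(Suc d, j) \<in> nodes \<Longrightarrow> (d, j div 2) \<in> nodes"
proof (cases "j div 2 = 0")
  case False
  assume "(Suc d, j) \<in> nodes"
  then obtain k where k: "onset k \<le> Suc d" "Suc d \<le> 2 * onset k" "j < 2 ^ (Suc d - onset k)"
    using False by (auto simp: nodes_def)
  have "onset k \<noteq> Suc d" using k False by (intro notI) simp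
  with k have le: "onset k \<le> d" by simp
  then have "j < 2 * 2 ^ (d - onset k)" using k(3) by (simp add: Suc_diff_le)
  then have "j div 2 < 2 ^ (d - onset k)" by (simp add: div_less_iff_less_mult mult.commute)
  with le k show ?thesis by (auto simp: nodes_def)
qed simp

lemma nodes_level_0: "(0, j) \<in> nodes \<Longrightarrow> j = 0"
  using onset_ge(1) by (fastforce simp: nodes_def)

text \<open>Tree \<open>k\<close> and the earlier ones have ended, and the next one begins with a
  single vertex. The upper end is included because the bottleneck will be placed there.\<close>

lemma nodes_between_onsets:
  assumes "(d, j) \<in> nodes" "2 * onset k < d" "d \<le> onset (Suc k)"
  shows "j = 0"
proof (rule ccontr)
  assume "j \<noteq> 0"
  then obtain l where l: "onset l \<le> d" "d \<le> 2 * onset l" "j < 2 ^ (d - onset l)"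
    using assms(1) by (auto simp: nodes_def)
  show False
  proof (cases "l \<le> k")
    case True
    then have "onset l \<le> onset k" by (rule incseqD[OF incseq_onset])
    with l assms show False by simp
  next
    case False
    then have "onset (Suc k) \<le> onset l" by (intro incseqD[OF incseq_onset]) simp
    with l assms have "d = onset l" by simp
    with l \<open>j \<noteq> 0\<close> show False by simp
  qed
qed

interpretation H: rooted_tree up "enc (0, 0)" "\<lambda>n. fst (dec n)"
proof
  show "fst (dec (enc (0, 0))) = 0" by simp
  fix w
  obtain d j where dj: "dec w = (d, j)" by (cases "dec w")
  show "fst (dec w) = Suc (fst (dec (up w)))" if "w \<noteq> enc (0, 0)"
  proof (cases d)
    case 0
    then have "dec w = (0, 0)" using nodes_level_0[of j] dec_in_nodes[of w] dj by simp
    then have "w = enc (0, 0)" by (metis enc_dec)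
    with that show ?thesis by simp
  next
    case (Suc d')
    then have "(d', j div 2) \<in> nodes" using nodes_Suc[of d' j] dec_in_nodes[of w] dj by simp
    with Suc dj show ?thesis by (simp add: up_def)
  qed
  \<comment> \<open>Halving has only two preimages, which bounds the number of children.\<close>
  have sub: "{c. c \<noteq> enc (0, 0) \<and> up c = w} \<subseteq> enc ` {(Suc d, 2 * j), (Suc d, Suc (2 * j))}"
  proof
    fix c assume c: "c \<in> {c. c \<noteq> enc (0, 0) \<and> up c = w}"
    obtain e i where ei: "dec c = (e, i)" by (cases "dec c")
    have "e \<noteq> 0"
    proof
      assume "e = 0"
      then have "dec c = (0, 0)" using nodes_level_0[of i] dec_in_nodes[of c] ei by simp
      with c show False by (metis (mono_tags) enc_dec mem_Collect_eq)
    qed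
    then obtain e' where e: "e = Suc e'" by (cases e) auto
    have "(e', i div 2) \<in> nodes" using nodes_Suc[of e' i] dec_in_nodes[of c] ei e by simp
    moreover have "enc (e', i div 2) = w" using c ei e by (simp add: up_def)
    ultimately have "(e', i div 2) = (d, j)" using dj by (metis dec_enc)
    then have "dec c \<in> {(Suc d, 2 * j), (Suc d, Suc (2 * j))}"
      using ei e by auto
    then show "c \<in> enc ` {(Suc d, 2 * j), (Suc d, Suc (2 * j))}" by (metis enc_dec imageI)
  qed
  then show "finite {c. c \<noteq> enc (0, 0) \<and> up c = w}" by (rule finite_subset) simp
  have "card {c. c \<noteq> enc (0, 0) \<and> up c = w} \<le> card (enc ` {(Suc d, 2 * j), (Suc d, Suc (2 * j))})"
    by (rule card_mono[OF _ sub]) simp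
  also have "\<dots> \<le> card {(Suc d, 2 * j), (Suc d, Suc (2 * j))}"
    by (rule card_image_le) simp
  finally show "card {c. c \<noteq> enc (0, 0) \<and> up c = w} \<le> 2" by simp
qed

text \<open>A level with a single vertex is a cut: going up from any deeper vertex one depth at a
  time must meet it.\<close>

lemma bottleneck:
  assumes "0 < l" and unique: "\<And>j. (l, j) \<in> nodes \<Longrightarrow> j = 0"
  shows "l \<le> fst (dec w) \<Longrightarrow> enc (l, 0) \<in> H.anc w"
proof (induction w rule: H.tree_induct)
  case root
  then show ?case using assms(1) by simp
next
  case (par w)
  show ?case
  proof (cases "fst (dec w) = l")
    case True
    then have "dec w = (l, 0)" using unique[of "snd (dec w)"] dec_in_nodes[of w] by (cases "dec w") auto
    then have "enc (l, 0) = w" by (metis enc_dec)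
    with par(1) show ?thesis by (simp add: H.anc_par)
  next
    case False
    then show ?thesis using par H.dep_par[OF par(1)] by (simp add: H.anc_par)
  qed
qed

text \<open>The constant is \<open>80 * 64\<close>: the bare segment has at most
  \<open>64 * a\<^sup>2\<close> vertices and must be 80 times smaller than \<open>A\<close>. The
  base case explains \<open>onset 0 = 32\<close>.\<close>

lemma square_le_exp:
  assumes "32 \<le> a"
  shows "5120 * a\<^sup>2 \<le> (2::nat) ^ a"
  using assms
proof (induction a rule: dec_induct)
  case (step a)
  have "5120 * (Suc a)\<^sup>2 \<le> 5120 * (2 * a\<^sup>2)"
  proof (rule mult_left_mono)
    have "32 * a \<le> a * a" using step(1) by (rule mult_right_mono) simp
    then have "Suc (a + a) \<le> a * a" using step(1) by linarith
    then show "(Suc a)\<^sup>2 \<le> 2 * a\<^sup>2" by (simp add: power2_eq_square)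
  qed simp
  also have "\<dots> \<le> 2 * 2 ^ a" using step by simp
  finally show ?case by simp
qed simp

lemma tree_scales:
  "\<exists>R A S q. r \<le> R \<and> finite A \<and> A \<noteq> {} \<and> (\<forall>y\<in>A. fst (dec y) \<le> R) \<and>
     finite S \<and> 80 * card S \<le> card A \<and> 16 * R\<^sup>2 \<le> fst (dec q) \<and>
     (\<forall>w. w \<in> A \<or> w \<in> S \<or> q \<in> H.anc w)"
proof -
  \<comment> \<open>The scale is \<open>R = 2 * a\<close>, the depth at which tree \<open>r\<close>
    ends. The bottleneck \<open>q\<close> is the ray vertex at depth \<open>onset (Suc r)\<close>,
    which equals \<open>16 * R\<^sup>2\<close>.\<close>
  define a where "a = onset r"
  define A where "A = {w. fst (dec w) \<le> 2 * a}"
  define S where "S = {w. 2 * a < fst (dec w) \<and> fst (dec w) < onset (Suc r)}"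
  have a32: "32 \<le> a" by (simp add: a_def onset_ge)
  have "j < 2 ^ (2 * a)" if nd: "(d, j) \<in> nodes" "d \<le> 2 * a" for d j
  proof (cases "j = 0")
    case False
    then obtain k where "j < 2 ^ (d - onset k)" using nd by (auto simp: nodes_def)
    also have "(2::nat) ^ (d - onset k) \<le> 2 ^ (2 * a)"
      using nd by (intro power_increasing) auto
    finally show ?thesis .
  qed simp
  then have "A \<subseteq> enc ` ({..2 * a} \<times> {..<2 ^ (2 * a)})"
  proof (intro subsetI)
    fix w assume w: "w \<in> A" and *: "\<And>d j. (d, j) \<in> nodes \<Longrightarrow> d \<le> 2 * a \<Longrightarrow> j < 2 ^ (2 * a)"
    have "dec w \<in> {..2 * a} \<times> {..<2 ^ (2 * a)}"
      using w *[of "fst (dec w)" "snd (dec w)"] dec_in_nodes[of w] by (cases "dec w") (auto simp: A_def)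
    then show "w \<in> enc ` ({..2 * a} \<times> {..<2 ^ (2 * a)})" by (metis enc_dec imageI)
  qed
  then have finA: "finite A" by (rule finite_subset) simp
  \<comment> \<open>The bottom level of tree \<open>r\<close> alone supplies the
    \<open>2 ^ a\<close> vertices of \<open>A\<close> that are needed.\<close>
  have leaf: "(2 * a, j) \<in> nodes" if "j < 2 ^ a" for j
    using that by (auto simp: nodes_def a_def intro!: exI[of _ r])
  have "2 ^ a = card ((\<lambda>j. enc (2 * a, j)) ` {..<2 ^ a})"
  proof (subst card_image)
    show "inj_on (\<lambda>j. enc (2 * a, j)) {..<2 ^ a}"
      by (rule inj_onI) (metis dec_enc leaf lessThan_iff prod.inject)
  qed simp
  also have "\<dots> \<le> card A"
    by (rule card_mono[OF finA]) (auto simp: A_def leaf)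
  finally have cA: "2 ^ a \<le> card A" .
  have S: "S \<subseteq> (\<lambda>d. enc (d, 0)) ` {..<onset (Suc r)}"
  proof
    fix w assume w: "w \<in> S"
    obtain d j where dj: "dec w = (d, j)" by (cases "dec w")
    have "j = 0"
      using nodes_between_onsets[of d j r] dec_in_nodes[of w] w dj by (simp add: S_def a_def)
    then have "w = enc (d, 0)" using dj by (metis enc_dec)
    then show "w \<in> (\<lambda>d. enc (d, 0)) ` {..<onset (Suc r)}" using w dj by (auto simp: S_def)
  qed
  have "card S \<le> card ((\<lambda>d. enc (d, 0)) ` {..<onset (Suc r)})"
    by (rule card_mono[OF _ S]) simp
  also have "\<dots> \<le> onset (Suc r)"
    using card_image_le[of "{..<onset (Suc r)}" "\<lambda>d. enc (d, 0)"] by simp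
  finally have "80 * card S \<le> 5120 * a\<^sup>2" by (simp add: a_def)
  also have "\<dots> \<le> 2 ^ a" by (rule square_le_exp[OF a32])
  finally have cS: "80 * card S \<le> card A" using cA by linarith
  have big: "2 * a < onset (Suc r)"
  proof -
    have "2 * a < (64 * a) * a" using a32 by (intro mult_strict_right_mono) auto
    then show ?thesis by (simp add: a_def power2_eq_square)
  qed
  have "enc (onset (Suc r), 0) \<in> H.anc w" if "onset (Suc r) \<le> fst (dec w)" for w
    using big by (intro bottleneck that nodes_between_onsets[of _ _ r]) (use a32 in \<open>auto simp: a_def\<close>)
  then have "\<forall>w. w \<in> A \<or> w \<in> S \<or> enc (onset (Suc r), 0) \<in> H.anc w"
    unfolding A_def S_def mem_Collect_eq by (meson not_le)
  moreover have "A \<noteq> {}" using cA by auto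
  moreover have "r \<le> 2 * a" using onset_ge(2)[of r] by (simp add: a_def)
  moreover have "finite S" using S by (rule finite_subset) simp
  moreover have "16 * (2 * a)\<^sup>2 \<le> fst (dec (enc (onset (Suc r), 0)))"
    by (simp add: a_def power_mult_distrib)
  ultimately show ?thesis
    using finA cS by (intro exI[of _ "2 * a"] exI[of _ A] exI[of _ S] exI[of _ "enc (onset (Suc r), 0)"])
      (auto simp: A_def)
qed

theorem theorem1p3:
  shows "\<exists>(E :: nat \<Rightarrow> nat \<Rightarrow> bool) v.
           simple_graph UNIV E \<and> bounded_degree UNIV E \<and> graph_connected UNIV E \<and>
           \<not> finite_collision_property (comb_vertices (UNIV :: int set) (UNIV :: nat set))
               (comb_edge Z_edge E v)"
proof (intro exI conjI)
  show "simple_graph UNIV H.tedge" by (rule H.simple_tedge)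
  show "bounded_degree UNIV H.tedge"
    unfolding bounded_degree_def by (intro exI[of _ 3]) (simp add: H.card_nbrs_tedge)
  show "graph_connected UNIV H.tedge" by (rule H.tedge_connected)
  show "\<not> finite_collision_property (comb_vertices UNIV UNIV) (comb_edge Z_edge H.tedge (enc (0, 0)))"
    by (rule comb_of_tree_not_finite_collision[OF H.rooted_tree_axioms tree_scales])
qed

end
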